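(* Let $\mathbf A$ be an additive DG-category with shifts and cones. Then the DG-category $\mathbf A^{\natural\natural}=(\mathbf A^\natural)^\natural$ can be naturally viewed as an intermediate full DG-subcategory between $\mathbf A(\mathbf{mc})$ and $\mathbf A(\mathbf{mc})^\oplus$, $$\mathbf A(\mathbf{mc})\subset\mathbf A^{\natural\natural}\subset\mathbf A(\mathbf{mc})^\oplus.$$ If the DG-category $\mathbf A$ is idempotent-complete, then $\mathbf A^{\natural\natural}=\mathbf A(\mathbf{mc})^\oplus$.
   Context: Gradings: fix an abelian group $\Gamma$, a symmetric bilinear form $\sigma\colon\Gamma\times\Gamma\to\mathbb Z/2$ and an element $\mathbf 1\in\Gamma$ with $\sigma(\mathbf 1,\mathbf 1)=1$; complexes are $\Gamma$-graded with differentials of degree $\mathbf 1$ (an integer $n$ denotes $n\cdot\mathbf 1$; $(-1)^i$ means $(-1)^{\sigma(\mathbf 1,i)}$), and signs follow the Koszul rule with $(-1)^{\sigma(a,b)}$ (standard case: $\Gamma=\mathbb Z$, $\sigma(a,b)=ab\bmod 2$). A DG-category $\mathbf A$ is a category enriched in complexes of abelian groups. $\mathsf Z^0(\mathbf A)$ is the preadditive category with the same objects and the degree-$0$ cocycles (closed morphisms of degree $0$) as morphisms. $\mathbf A$ is additive if $\mathsf Z^0(\mathbf A)$ is additive; an additive DG-category $\mathbf A$ is idempotent-complete if all idempotents split in $\mathsf Z^0(\mathbf A)$. Shift $X[i]$: an object with mutually inverse closed morphisms in $\operatorname{Hom}^{-i}_{\mathbf A}(X,X[i])$ and $\operatorname{Hom}^{i}_{\mathbf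 A}(X[i],X)$. The cone of a closed degree-$0$ morphism $f\colon X\to Y$ is an object $C$ with isomorphisms, functorial in $Z$, between $\operatorname{Hom}^\bullet_{\mathbf A}(Z,C)$ and the cone of $\operatorname{Hom}^\bullet_{\mathbf A}(Z,X)\to\operatorname{Hom}^\bullet_{\mathbf A}(Z,Y)$. A full DG-subcategory is a subclass of objects with the induced complexes of morphisms. DG-categories are considered up to equivalence, where an equivalence is a DG-functor inducing termwise isomorphisms on the complexes of morphisms and essentially surjective up to closed isomorphisms of degree $0$. The DG-category $\mathbf A^\natural$: objects are pairs $(X,\sigma_X)$ with $X\in\mathbf A$, $\sigma_X\in\operatorname{Hom}^{-1}_{\mathbf A}(X,X)$, $d(\sigma_X)=\mathrm{id}_X$, $\sigma_X^2=0$; $\operatorname{Hom}^i_{\mathbf A^\natural}((X,\sigma_X),(Y,\sigma_Y))$ is the group of closed morphisms $X\to Y$ of degree $-i$ in $\mathbf A$, with differential $d^\natural(f)=\sigma_Yf-(-1)^if\sigma_X$, and composition as in $\mathbf A$. Idempotent completion $\mathbf A^\oplus$ of an additive DG-category $\mathbf A$: objects are pairs $(A,e_A)$ with $A\in\mathbf A$ and $e_A$ a closed idempotent endomorphism of $A$ of degree $0$; $\operatorname{Hom}^\bullet_{\mathbf A^\oplus}((A,e_A),(B,e_B))=e_B\operatorname{Hom}^\bullet_{\mathbf A}(A,B)e_A$; composition as in $\mathbf A$. Twist (Maurer–Cartan) completion $\mathbf A(\mathbf{mc})$: objects are pairs $(A,a_A)$ with $A\in\mathbf A$ and $a_A\in\operatorname{Hom}^1_{\mathbf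 A}(A,A)$ such that $d(a_A)+a_A^2=0$; the graded group of morphisms $(A,a_A)\to(B,a_B)$ is $\operatorname{Hom}^*_{\mathbf A}(A,B)$ with the differential $f\mapsto d(f)+a_Bf-(-1)^{|f|}fa_A$; composition as in $\mathbf A$. $\mathbf A(\mathbf{mc})^\oplus$ means $(\mathbf A(\mathbf{mc}))^\oplus$. *)

theory Defs
  imports "HOL-Library.Z2" "HOL-Library.Product_Plus"
begin

section \<open>Gradings and DG-categories\<close>

locale grading =
  fixes \<sigma> :: "'g::ab_group_add \<Rightarrow> 'g \<Rightarrow> bit" and u :: 'g
  assumes form_add: "\<sigma> (a + b) c = \<sigma> a c + \<sigma> b c"
    and form_sym: "\<sigma> a b = \<sigma> b a"
    and form_unit: "\<sigma> u u = 1"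

text \<open>\<open>u\<close> is the degree of the differentials, and \<open>ksgn \<epsilon> f\<close> is \<open>(-1)\<^sup>\<epsilon> f\<close>.\<close>

definition ksgn :: "bit \<Rightarrow> 'm::ab_group_add \<Rightarrow> 'm" where
  "ksgn \<epsilon> f = (if \<epsilon> = 0 then f else - f)"

text \<open>
  \<open>Hom A X Y n\<close> is the degree-\<open>n\<close> component of the complex of morphisms from \<open>X\<close> to \<open>Y\<close>. All these
  groups are subgroups of one ambient abelian group \<open>'m\<close>, and \<open>comp A\<close> is one operation on \<open>'m\<close>. This
  loses no generality: let \<open>'m\<close> be the direct sum of all the groups of morphisms, with the
  matrix-type composition. No disjointness of the groups is required; in the
  constructions below (as in the mathematics) the same element may be a morphism between several
  pairs of objects, with differentials depending on the pair. This is why \<open>dif\<close> carries the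
  objects and the degree.
\<close>

record ('o, 'g, 'm) dgcat =
  Ob :: "'o set"
  Hom :: "'o \<Rightarrow> 'o \<Rightarrow> 'g \<Rightarrow> 'm set"
  dif :: "'o \<Rightarrow> 'o \<Rightarrow> 'g \<Rightarrow> 'm \<Rightarrow> 'm"
  comp :: "'m \<Rightarrow> 'm \<Rightarrow> 'm" (infixl "\<cdot>\<index>" 70)
  idm :: "'o \<Rightarrow> 'm"

locale dg_category = grading \<sigma> u
  for \<sigma> :: "'g::ab_group_add \<Rightarrow> 'g \<Rightarrow> bit" and u :: 'g +
  fixes A :: "('o, 'g, 'm::ab_group_add) dgcat" (structure)
  assumes Hom_zero: "\<lbrakk>X \<in> Ob A; Y \<in> Ob A\<rbrakk> \<Longrightarrow> 0 \<in> Hom A X Y n"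
    and Hom_add: "\<lbrakk>X \<in> Ob A; Y \<in> Ob A; f \<in> Hom A X Y n; g \<in> Hom A X Y n\<rbrakk> \<Longrightarrow> f + g \<in> Hom A X Y n"
    and Hom_minus: "\<lbrakk>X \<in> Ob A; Y \<in> Ob A; f \<in> Hom A X Y n\<rbrakk> \<Longrightarrow> - f \<in> Hom A X Y n"
    and dif_Hom: "\<lbrakk>X \<in> Ob A; Y \<in> Ob A; f \<in> Hom A X Y n\<rbrakk> \<Longrightarrow> dif A X Y n f \<in> Hom A X Y (n + u)"
    and dif_add: "\<lbrakk>X \<in> Ob A; Y \<in> Ob A; f \<in> Hom A X Y n; g \<in> Hom A X Y n\<rbrakk>
          \<Longrightarrow> dif A X Y n (f + g) = dif A X Y n f + dif A X Y n g"
    and dif_dif: "\<lbrakk>X \<in> Ob A; Y \<in> Ob A; f \<in> Hom A X Y n\<rbrakk>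
          \<Longrightarrow> dif A X Y (n + u) (dif A X Y n f) = 0"
    and comp_Hom: "\<lbrakk>X \<in> Ob A; Y \<in> Ob A; Z \<in> Ob A; f \<in> Hom A X Y n; g \<in> Hom A Y Z m\<rbrakk>
          \<Longrightarrow> g \<cdot> f \<in> Hom A X Z (m + n)"
    and comp_add_left: "\<lbrakk>X \<in> Ob A; Y \<in> Ob A; Z \<in> Ob A; f \<in> Hom A X Y n;
            g \<in> Hom A Y Z m; g' \<in> Hom A Y Z m\<rbrakk> \<Longrightarrow> (g + g') \<cdot> f = g \<cdot> f + g' \<cdot> f"
    and comp_add_right: "\<lbrakk>X \<in> Ob A; Y \<in> Ob A; Z \<in> Ob A; f \<in> Hom A X Y n;
            f' \<in> Hom A X Y n; g \<in> Hom A Y Z m\<rbrakk> \<Longrightarrow> g \<cdot> (f + f') = g \<cdot> f + g \<cdot> f'"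
    and comp_assoc: "\<lbrakk>W \<in> Ob A; X \<in> Ob A; Y \<in> Ob A; Z \<in> Ob A; f \<in> Hom A W X n;
            g \<in> Hom A X Y m; h \<in> Hom A Y Z l\<rbrakk> \<Longrightarrow> h \<cdot> g \<cdot> f = h \<cdot> (g \<cdot> f)"
    and idm_Hom: "X \<in> Ob A \<Longrightarrow> idm A X \<in> Hom A X X 0"
    and idm_left: "\<lbrakk>X \<in> Ob A; Y \<in> Ob A; f \<in> Hom A X Y n\<rbrakk> \<Longrightarrow> idm A Y \<cdot> f = f"
    and idm_right: "\<lbrakk>X \<in> Ob A; Y \<in> Ob A; f \<in> Hom A X Y n\<rbrakk> \<Longrightarrow> f \<cdot> idm A X = f"
    and dif_idm: "X \<in> Ob A \<Longrightarrow> dif A X X 0 (idm A X) = 0"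
    and dif_comp: "\<lbrakk>X \<in> Ob A; Y \<in> Ob A; Z \<in> Ob A; f \<in> Hom A X Y n; g \<in> Hom A Y Z m\<rbrakk>
          \<Longrightarrow> dif A X Z (m + n) (g \<cdot> f) = dif A Y Z m g \<cdot> f + ksgn (\<sigma> u m) (g \<cdot> dif A X Y n f)"


section \<open>The category \<open>Z\<^sup>0(A)\<close>, additivity, idempotents\<close>

record ('o, 'm) precat =
  Obj :: "'o set"
  Mor :: "'o \<Rightarrow> 'o \<Rightarrow> 'm set"
  cmp :: "'m \<Rightarrow> 'm \<Rightarrow> 'm" (infixl "\<odot>\<index>" 70)
  ide :: "'o \<Rightarrow> 'm"

definition closed_mor :: "('o, 'g, 'm::ab_group_add) dgcat \<Rightarrow> 'o \<Rightarrow> 'o \<Rightarrow> 'g \<Rightarrow> 'm set" where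
  "closed_mor A X Y n = {f \<in> Hom A X Y n. dif A X Y n f = 0}"

definition Z0 :: "('o, 'g::ab_group_add, 'm::ab_group_add) dgcat \<Rightarrow> ('o, 'm) precat" where
  "Z0 A = \<lparr>Obj = Ob A, Mor = (\<lambda>X Y. closed_mor A X Y 0), cmp = comp A, ide = idm A\<rparr>"

text \<open>For preadditive \<open>C\<close> only; the sums and zeros are those of the ambient group \<open>'m\<close>.\<close>

definition is_zero_object :: "('o, 'm::ab_group_add) precat \<Rightarrow> 'o \<Rightarrow> bool" where
  "is_zero_object C N \<longleftrightarrow> N \<in> Obj C \<and> (\<forall>X\<in>Obj C. Mor C N X = {0} \<and> Mor C X N = {0})"

definition is_biproduct :: "('o, 'm::ab_group_add) precat \<Rightarrow> 'o \<Rightarrow> 'o \<Rightarrow> 'o \<Rightarrow> bool" where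
  "is_biproduct C X Y W \<longleftrightarrow> W \<in> Obj C \<and>
     (\<exists>i\<in>Mor C X W. \<exists>j\<in>Mor C Y W. \<exists>p\<in>Mor C W X. \<exists>q\<in>Mor C W Y.
        p \<odot>\<^bsub>C\<^esub> i = ide C X \<and> q \<odot>\<^bsub>C\<^esub> j = ide C Y \<and> p \<odot>\<^bsub>C\<^esub> j = 0 \<and> q \<odot>\<^bsub>C\<^esub> i = 0 \<and>
        i \<odot>\<^bsub>C\<^esub> p + j \<odot>\<^bsub>C\<^esub> q = ide C W)"

definition additive_cat :: "('o, 'm::ab_group_add) precat \<Rightarrow> bool" where
  "additive_cat C \<longleftrightarrow> (\<exists>N. is_zero_object C N) \<and> (\<forall>X\<in>Obj C. \<forall>Y\<in>Obj C. \<exists>W. is_biproduct C X Y W)"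

definition idempotents_split :: "('o, 'm) precat \<Rightarrow> bool" where
  "idempotents_split C \<longleftrightarrow>
     (\<forall>X\<in>Obj C. \<forall>e\<in>Mor C X X. e \<odot>\<^bsub>C\<^esub> e = e \<longrightarrow>
        (\<exists>Y\<in>Obj C. \<exists>p\<in>Mor C X Y. \<exists>i\<in>Mor C Y X. p \<odot>\<^bsub>C\<^esub> i = ide C Y \<and> i \<odot>\<^bsub>C\<^esub> p = e))"

definition isomorphic_in :: "('o, 'm) precat \<Rightarrow> 'o \<Rightarrow> 'o \<Rightarrow> bool" where
  "isomorphic_in C X Y \<longleftrightarrow>
     (\<exists>f\<in>Mor C X Y. \<exists>g\<in>Mor C Y X. g \<odot>\<^bsub>C\<^esub> f = ide C X \<and> f \<odot>\<^bsub>C\<^esub> g = ide C Y)"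

definition dg_additive :: "('o, 'g::ab_group_add, 'm::ab_group_add) dgcat \<Rightarrow> bool" where
  "dg_additive A \<longleftrightarrow> additive_cat (Z0 A)"

definition dg_idempotent_complete :: "('o, 'g::ab_group_add, 'm::ab_group_add) dgcat \<Rightarrow> bool" where
  "dg_idempotent_complete A \<longleftrightarrow> dg_additive A \<and> idempotents_split (Z0 A)"


section \<open>Shifts and cones\<close>

definition is_shift :: "('o, 'g::ab_group_add, 'm::ab_group_add) dgcat \<Rightarrow> 'o \<Rightarrow> 'g \<Rightarrow> 'o \<Rightarrow> bool" where
  "is_shift A X i S \<longleftrightarrow> S \<in> Ob A \<and>
     (\<exists>f\<in>closed_mor A X S (- i). \<exists>g\<in>closed_mor A S X i.
        g \<cdot>\<^bsub>A\<^esub> f = idm A X \<and> f \<cdot>\<^bsub>A\<^esub> g = idm A S)"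

definition has_shifts :: "('o, 'g::ab_group_add, 'm::ab_group_add) dgcat \<Rightarrow> bool" where
  "has_shifts A \<longleftrightarrow> (\<forall>X\<in>Ob A. \<forall>i. \<exists>S. is_shift A X i S)"

text \<open>
  The cone of a morphism of complexes \<open>\<phi> : K \<rightarrow> L\<close> has components \<open>K\<^sup>n\<^sup>+\<^sup>1 \<oplus> L\<^sup>n\<close> and differential
  \<open>(k, l) \<mapsto> (- d k, \<phi> k + d l)\<close>. Here \<open>\<phi>\<close> is composition with \<open>f : X \<rightarrow> Y\<close>, from \<open>Hom(Z, X)\<close> to
  \<open>Hom(Z, Y)\<close>.
\<close>

definition cone_Hom :: "'g \<Rightarrow> ('o, 'g::ab_group_add, 'm::ab_group_add) dgcat \<Rightarrow> 'o \<Rightarrow> 'o \<Rightarrow> 'o \<Rightarrow> 'g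
    \<Rightarrow> ('m \<times> 'm) set" where
  "cone_Hom u A X Y Z n = Hom A Z X (n + u) \<times> Hom A Z Y n"

definition cone_dif :: "'g \<Rightarrow> ('o, 'g::ab_group_add, 'm::ab_group_add) dgcat \<Rightarrow> 'o \<Rightarrow> 'o \<Rightarrow> 'm \<Rightarrow> 'o \<Rightarrow> 'g
    \<Rightarrow> 'm \<times> 'm \<Rightarrow> 'm \<times> 'm" where
  "cone_dif u A X Y f Z n = (\<lambda>(k, l). (- dif A Z X (n + u) k, f \<cdot>\<^bsub>A\<^esub> k + dif A Z Y n l))"

text \<open>
  Functoriality in \<open>Z\<close> is that of DG-functors, i.e. with respect to morphisms \<open>h : Z' \<rightarrow> Z\<close> of all
  degrees, closed or not. Precomposition with \<open>h\<close> commutes with the shift of \<open>K\<close>, applied on the other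
  side, without a sign.
\<close>

definition is_cone :: "'g \<Rightarrow> ('o, 'g::ab_group_add, 'm::ab_group_add) dgcat \<Rightarrow> 'o \<Rightarrow> 'o \<Rightarrow> 'm \<Rightarrow> 'o \<Rightarrow> bool" where
  "is_cone u A X Y f C \<longleftrightarrow> C \<in> Ob A \<and>
     (\<exists>\<Phi> :: 'o \<Rightarrow> 'g \<Rightarrow> 'm \<Rightarrow> 'm \<times> 'm.
        (\<forall>Z\<in>Ob A. \<forall>n. bij_betw (\<Phi> Z n) (Hom A Z C n) (cone_Hom u A X Y Z n)) \<and>
        (\<forall>Z\<in>Ob A. \<forall>n. \<forall>a\<in>Hom A Z C n. \<forall>b\<in>Hom A Z C n. \<Phi> Z n (a + b) = \<Phi> Z n a + \<Phi> Z n b) \<and>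
        (\<forall>Z\<in>Ob A. \<forall>n. \<forall>a\<in>Hom A Z C n.
           \<Phi> Z (n + u) (dif A Z C n a) = cone_dif u A X Y f Z n (\<Phi> Z n a)) \<and>
        (\<forall>Z\<in>Ob A. \<forall>Z'\<in>Ob A. \<forall>n m. \<forall>a\<in>Hom A Z C n. \<forall>h\<in>Hom A Z' Z m.
           \<Phi> Z' (n + m) (a \<cdot>\<^bsub>A\<^esub> h) = map_prod (\<lambda>k. k \<cdot>\<^bsub>A\<^esub> h) (\<lambda>l. l \<cdot>\<^bsub>A\<^esub> h) (\<Phi> Z n a)))"

definition has_cones :: "'g \<Rightarrow> ('o, 'g::ab_group_add, 'm::ab_group_add) dgcat \<Rightarrow> bool" where
  "has_cones u A \<longleftrightarrow> (\<forall>X\<in>Ob A. \<forall>Y\<in>Ob A. \<forall>f\<in>closed_mor A X Y 0. \<exists>C. is_cone u A X Y f C)"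


section \<open>DG-functors, equivalences, full DG-subcategories\<close>

text \<open>
  A DG-functor is given by \<open>F\<close> on objects and, for each \<open>X\<close>, \<open>Y\<close>, \<open>n\<close>, by a map \<open>\<phi> X Y n\<close> on \<open>Hom A X Y n\<close>.
\<close>

definition dg_functor :: "'g \<Rightarrow> ('o, 'g::ab_group_add, 'm::ab_group_add) dgcat \<Rightarrow>
    ('p, 'g, 'n::ab_group_add) dgcat \<Rightarrow> ('o \<Rightarrow> 'p) \<Rightarrow> ('o \<Rightarrow> 'o \<Rightarrow> 'g \<Rightarrow> 'm \<Rightarrow> 'n) \<Rightarrow> bool" where
  "dg_functor u A B F \<phi> \<longleftrightarrow>
     (\<forall>X\<in>Ob A. F X \<in> Ob B) \<and>
     (\<forall>X\<in>Ob A. \<forall>Y\<in>Ob A. \<forall>n. \<forall>f\<in>Hom A X Y n. \<phi> X Y n f \<in> Hom B (F X) (F Y) n) \<and>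
     (\<forall>X\<in>Ob A. \<forall>Y\<in>Ob A. \<forall>n. \<forall>f\<in>Hom A X Y n. \<forall>g\<in>Hom A X Y n.
        \<phi> X Y n (f + g) = \<phi> X Y n f + \<phi> X Y n g) \<and>
     (\<forall>X\<in>Ob A. \<forall>Y\<in>Ob A. \<forall>n. \<forall>f\<in>Hom A X Y n.
        \<phi> X Y (n + u) (dif A X Y n f) = dif B (F X) (F Y) n (\<phi> X Y n f)) \<and>
     (\<forall>X\<in>Ob A. \<forall>Y\<in>Ob A. \<forall>Z\<in>Ob A. \<forall>m n. \<forall>f\<in>Hom A X Y n. \<forall>g\<in>Hom A Y Z m.
        \<phi> X Z (m + n) (g \<cdot>\<^bsub>A\<^esub> f) = \<phi> Y Z m g \<cdot>\<^bsub>B\<^esub> \<phi> X Y n f) \<and>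
     (\<forall>X\<in>Ob A. \<phi> X X 0 (idm A X) = idm B (F X))"

definition dg_equivalence :: "'g \<Rightarrow> ('o, 'g::ab_group_add, 'm::ab_group_add) dgcat \<Rightarrow>
    ('p, 'g, 'n::ab_group_add) dgcat \<Rightarrow> ('o \<Rightarrow> 'p) \<Rightarrow> ('o \<Rightarrow> 'o \<Rightarrow> 'g \<Rightarrow> 'm \<Rightarrow> 'n) \<Rightarrow> bool" where
  "dg_equivalence u A B F \<phi> \<longleftrightarrow> dg_functor u A B F \<phi> \<and>
     (\<forall>X\<in>Ob A. \<forall>Y\<in>Ob A. \<forall>n. bij_betw (\<phi> X Y n) (Hom A X Y n) (Hom B (F X) (F Y) n)) \<and>
     (\<forall>Y\<in>Ob B. \<exists>X\<in>Ob A. isomorphic_in (Z0 B) (F X) Y)"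

definition full_dg_subcat :: "('o, 'g, 'm) dgcat \<Rightarrow> 'o set \<Rightarrow> ('o, 'g, 'm) dgcat" where
  "full_dg_subcat A S = A\<lparr>Ob := S\<rparr>"


section \<open>The constructions\<close>

definition natural_dg :: "('g::ab_group_add \<Rightarrow> 'g \<Rightarrow> bit) \<Rightarrow> 'g \<Rightarrow> ('o, 'g, 'm::ab_group_add) dgcat
    \<Rightarrow> ('o \<times> 'm, 'g, 'm) dgcat" where
  "natural_dg \<sigma> u A =
     \<lparr>Ob = {(X, s). X \<in> Ob A \<and> s \<in> Hom A X X (- u) \<and> dif A X X (- u) s = idm A X \<and> s \<cdot>\<^bsub>A\<^esub> s = 0},
      Hom = (\<lambda>(X, s) (Y, t) i. closed_mor A X Y (- i)),
      dif = (\<lambda>(X, s) (Y, t) i f. t \<cdot>\<^bsub>A\<^esub> f - ksgn (\<sigma> u i) (f \<cdot>\<^bsub>A\<^esub> s)),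
      comp = comp A,
      idm = (\<lambda>(X, s). idm A X)\<rparr>"

definition idem_dg :: "('o, 'g::ab_group_add, 'm::ab_group_add) dgcat \<Rightarrow> ('o \<times> 'm, 'g, 'm) dgcat" where
  "idem_dg A =
     \<lparr>Ob = {(X, e). X \<in> Ob A \<and> e \<in> closed_mor A X X 0 \<and> e \<cdot>\<^bsub>A\<^esub> e = e},
      Hom = (\<lambda>(X, e) (Y, e') n. {e' \<cdot>\<^bsub>A\<^esub> f \<cdot>\<^bsub>A\<^esub> e |f. f \<in> Hom A X Y n}),
      dif = (\<lambda>(X, e) (Y, e') n. dif A X Y n),
      comp = comp A,
      idm = (\<lambda>(X, e). e)\<rparr>"

definition mc_dg :: "('g::ab_group_add \<Rightarrow> 'g \<Rightarrow> bit) \<Rightarrow> 'g \<Rightarrow> ('o, 'g, 'm::ab_group_add) dgcat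
    \<Rightarrow> ('o \<times> 'm, 'g, 'm) dgcat" where
  "mc_dg \<sigma> u A =
     \<lparr>Ob = {(X, a). X \<in> Ob A \<and> a \<in> Hom A X X u \<and> dif A X X u a + a \<cdot>\<^bsub>A\<^esub> a = 0},
      Hom = (\<lambda>(X, a) (Y, b). Hom A X Y),
      dif = (\<lambda>(X, a) (Y, b) n f. dif A X Y n f + b \<cdot>\<^bsub>A\<^esub> f - ksgn (\<sigma> u n) (f \<cdot>\<^bsub>A\<^esub> a)),
      comp = comp A,
      idm = (\<lambda>(X, a). idm A X)\<rparr>"

text \<open>
  The objects \<open>(X, id\<^sub>X)\<close> of the idempotent completion. They form a full DG-subcategory isomorphic to
  \<open>A\<close> via \<open>X \<mapsto> (X, id\<^sub>X)\<close>, \<open>f \<mapsto> f\<close>; this is the canonical inclusion of \<open>A\<close> in its idempotent completion.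
\<close>

definition idem_embedding_obs :: "('o, 'g, 'm) dgcat \<Rightarrow> ('o \<times> 'm) set" where
  "idem_embedding_obs A = (\<lambda>X. (X, idm A X)) ` Ob A"

section \<open>The constructions yield DG-categories\<close>

lemma ksgn_simps [simp]: "ksgn 0 f = f" "ksgn 1 f = - f" "ksgn \<epsilon> 0 = 0"
  by (simp_all add: ksgn_def)

lemma ksgn_add: "ksgn \<epsilon> (f + g) = ksgn \<epsilon> f + ksgn \<epsilon> g"
  by (simp add: ksgn_def)

lemma ksgn_minus: "ksgn \<epsilon> (- f) = - ksgn \<epsilon> f"
  by (simp add: ksgn_def)

lemma ksgn_diff: "ksgn \<epsilon> (f - g) = ksgn \<epsilon> f - ksgn \<epsilon> g"
  by (simp add: ksgn_def)

lemma ksgn_ksgn: "ksgn \<epsilon> (ksgn \<delta> f) = ksgn (\<epsilon> + \<delta>) f"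
  by (cases \<epsilon>; cases \<delta>) (simp_all add: ksgn_def)

lemma ksgn_twice: "ksgn \<epsilon> (ksgn \<epsilon> f) = f"
  by (simp add: ksgn_def)

context grading
begin

lemma form_zero: "\<sigma> a 0 = 0" "\<sigma> 0 a = 0"
proof -
  have "\<sigma> 0 a = \<sigma> 0 a + \<sigma> 0 a"
    using form_add[of 0 0 a] by simp
  then show "\<sigma> 0 a = 0" by (cases "\<sigma> 0 a") auto
  then show "\<sigma> a 0 = 0" by (simp add: form_sym)
qed

lemma form_add_right: "\<sigma> a (b + c) = \<sigma> a b + \<sigma> a c"
  by (metis form_add form_sym)

lemma form_minus: "\<sigma> a (- b) = \<sigma> a b"
proof -
  have "\<sigma> a b + \<sigma> a (- b) = 0"
    using form_add_right[of a b "- b"] by (simp only: right_minus form_zero)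
  then show ?thesis by (cases "\<sigma> a b"; cases "\<sigma> a (- b)") auto
qed

lemma ksgn_unit: "ksgn (\<sigma> u (n + u)) f = - ksgn (\<sigma> u n) f"
  by (cases "\<sigma> u n") (simp_all only: form_add_right form_unit, simp_all)

lemma ksgn_form_add: "ksgn (\<sigma> u (m + n)) f = ksgn (\<sigma> u m) (ksgn (\<sigma> u n) f)"
  by (simp only: form_add_right ksgn_ksgn)

end

context dg_category
begin

lemma Hom_diff: "\<lbrakk>X \<in> Ob A; Y \<in> Ob A; f \<in> Hom A X Y n; g \<in> Hom A X Y n\<rbrakk> \<Longrightarrow> f - g \<in> Hom A X Y n"
  using Hom_add[of X Y f n "- g"] Hom_minus[of X Y g n] by simp

lemma Hom_ksgn: "\<lbrakk>X \<in> Ob A; Y \<in> Ob A; f \<in> Hom A X Y n\<rbrakk> \<Longrightarrow> ksgn \<epsilon> f \<in> Hom A X Y n"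
  by (simp add: ksgn_def Hom_minus)

lemma dif_zero: "\<lbrakk>X \<in> Ob A; Y \<in> Ob A\<rbrakk> \<Longrightarrow> dif A X Y n 0 = 0"
  using dif_add[of X Y 0 n 0] Hom_zero[of X Y n] by simp

lemma dif_minus: "\<lbrakk>X \<in> Ob A; Y \<in> Ob A; f \<in> Hom A X Y n\<rbrakk> \<Longrightarrow> dif A X Y n (- f) = - dif A X Y n f"
  using dif_add[of X Y f n "- f"] by (simp add: Hom_minus dif_zero eq_neg_iff_add_eq_0 add.commute)

lemma dif_ksgn: "\<lbrakk>X \<in> Ob A; Y \<in> Ob A; f \<in> Hom A X Y n\<rbrakk> \<Longrightarrow> dif A X Y n (ksgn \<epsilon> f) = ksgn \<epsilon> (dif A X Y n f)"
  by (simp add: ksgn_def dif_minus)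

lemma dif_diff: "\<lbrakk>X \<in> Ob A; Y \<in> Ob A; f \<in> Hom A X Y n; g \<in> Hom A X Y n\<rbrakk>
    \<Longrightarrow> dif A X Y n (f - g) = dif A X Y n f - dif A X Y n g"
  using dif_add[of X Y f n "- g"] by (simp add: Hom_minus dif_minus)

lemma comp_zero_left: "\<lbrakk>X \<in> Ob A; Y \<in> Ob A; f \<in> Hom A X Y n\<rbrakk> \<Longrightarrow> 0 \<cdot> f = 0"
  using comp_add_left[of X Y Y f n 0 0 0] by (simp add: Hom_zero)

lemma comp_zero_right: "\<lbrakk>X \<in> Ob A; Y \<in> Ob A; f \<in> Hom A X Y n\<rbrakk> \<Longrightarrow> f \<cdot> 0 = 0"
  using comp_add_right[of X X Y 0 0 0 f n] by (simp add: Hom_zero)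

lemma comp_minus_left: "\<lbrakk>X \<in> Ob A; Y \<in> Ob A; Z \<in> Ob A; f \<in> Hom A X Y n; g \<in> Hom A Y Z m\<rbrakk>
    \<Longrightarrow> (- g) \<cdot> f = - (g \<cdot> f)"
  using comp_add_left[of X Y Z f n g m "- g"]
  by (simp add: Hom_minus comp_zero_left eq_neg_iff_add_eq_0 add.commute)

lemma comp_minus_right: "\<lbrakk>X \<in> Ob A; Y \<in> Ob A; Z \<in> Ob A; f \<in> Hom A X Y n; g \<in> Hom A Y Z m\<rbrakk>
    \<Longrightarrow> g \<cdot> (- f) = - (g \<cdot> f)"
  using comp_add_right[of X Y Z f n "- f" g m]
  by (simp add: Hom_minus comp_zero_right eq_neg_iff_add_eq_0 add.commute)

lemma comp_ksgn_left: "\<lbrakk>X \<in> Ob A; Y \<in> Ob A; Z \<in> Ob A; f \<in> Hom A X Y n; g \<in> Hom A Y Z m\<rbrakk>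
    \<Longrightarrow> ksgn \<epsilon> g \<cdot> f = ksgn \<epsilon> (g \<cdot> f)"
  by (simp add: ksgn_def comp_minus_left)

lemma comp_ksgn_right: "\<lbrakk>X \<in> Ob A; Y \<in> Ob A; Z \<in> Ob A; f \<in> Hom A X Y n; g \<in> Hom A Y Z m\<rbrakk>
    \<Longrightarrow> g \<cdot> ksgn \<epsilon> f = ksgn \<epsilon> (g \<cdot> f)"
  by (simp add: ksgn_def comp_minus_right)

lemma comp_diff_left: "\<lbrakk>X \<in> Ob A; Y \<in> Ob A; Z \<in> Ob A; f \<in> Hom A X Y n;
    g \<in> Hom A Y Z m; g' \<in> Hom A Y Z m\<rbrakk> \<Longrightarrow> (g - g') \<cdot> f = g \<cdot> f - g' \<cdot> f"
  using comp_add_left[of X Y Z f n g m "- g'"] by (simp add: Hom_minus comp_minus_left)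

lemma comp_diff_right: "\<lbrakk>X \<in> Ob A; Y \<in> Ob A; Z \<in> Ob A; f \<in> Hom A X Y n;
    f' \<in> Hom A X Y n; g \<in> Hom A Y Z m\<rbrakk> \<Longrightarrow> g \<cdot> (f - f') = g \<cdot> f - g \<cdot> f'"
  using comp_add_right[of X Y Z f n "- f'" g m] by (simp add: Hom_minus comp_minus_right)

lemma dg_category_mc_dg: "dg_category \<sigma> u (mc_dg \<sigma> u A)"
proof unfold_locales
  let ?M = "mc_dg \<sigma> u A"
  have unf: "Ob ?M = {(X, a). X \<in> Ob A \<and> a \<in> Hom A X X u \<and> dif A X X u a + a \<cdot> a = 0}"
    "\<And>X a Y b. Hom ?M (X, a) (Y, b) = Hom A X Y"
    "\<And>X a Y b n f. dif ?M (X, a) (Y, b) n f = dif A X Y n f + b \<cdot> f - ksgn (\<sigma> u n) (f \<cdot> a)"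
    "comp ?M = comp A" "\<And>X a. idm ?M (X, a) = idm A X"
    by (simp_all add: mc_dg_def)
  have L: "b \<cdot> f \<in> Hom A X Y (n + u)" if "X \<in> Ob A" "Y \<in> Ob A" "f \<in> Hom A X Y n" "b \<in> Hom A Y Y u"
    for X Y f n b using comp_Hom[of X Y Y f n b u] that by (simp add: add.commute)
  have R: "f \<cdot> a \<in> Hom A X Y (n + u)" if "X \<in> Ob A" "Y \<in> Ob A" "f \<in> Hom A X Y n" "a \<in> Hom A X X u"
    for X Y f n a using comp_Hom[of X X Y a u f n] that by simp
  fix P Q R' S :: "'o \<times> 'm" and f g h f' g' :: 'm and n m l :: 'g
  obtain X a Y b Z c W w where [simp]: "P = (X, a)" "Q = (Y, b)" "R' = (Z, c)" "S = (W, w)"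
    by (metis surj_pair)
  {
    assume "P \<in> Ob ?M" "Q \<in> Ob ?M"
    then have ob: "X \<in> Ob A" "Y \<in> Ob A" "a \<in> Hom A X X u" "b \<in> Hom A Y Y u"
      and MC: "dif A X X u a + a \<cdot> a = 0" "dif A Y Y u b + b \<cdot> b = 0" by (auto simp: unf)
    from ob show "0 \<in> Hom ?M P Q n" by (simp add: unf Hom_zero)
    assume "f \<in> Hom ?M P Q n"
    then have f: "f \<in> Hom A X Y n" by (simp add: unf)
    from ob f show "- f \<in> Hom ?M P Q n" by (simp add: unf Hom_minus)
    from ob f show "dif ?M P Q n f \<in> Hom ?M P Q (n + u)"
      by (simp add: unf dif_Hom L R Hom_add Hom_diff Hom_ksgn)
    from ob f show "idm ?M Q \<cdot>\<^bsub>?M\<^esub> f = f" by (simp add: unf idm_left)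
    from ob f show "f \<cdot>\<^bsub>?M\<^esub> idm ?M P = f" by (simp add: unf idm_right)
    have Lf: "b \<cdot> f \<in> Hom A X Y (n + u)" and Rf: "f \<cdot> a \<in> Hom A X Y (n + u)" using ob f by (auto intro: L R)
    have df: "dif A X Y n f \<in> Hom A X Y (n + u)" using ob f by (auto intro: dif_Hom)
    have dl: "dif A X Y (n + u) (b \<cdot> f) = dif A Y Y u b \<cdot> f - b \<cdot> dif A X Y n f"
      using dif_comp[of X Y Y f n b u] ob f by (simp add: form_unit add.commute)
    have dr: "dif A X Y (n + u) (f \<cdot> a) = dif A X Y n f \<cdot> a + ksgn (\<sigma> u n) (f \<cdot> dif A X X u a)"
      using dif_comp[of X X Y a u f n] ob f by simp
    have da: "dif A X X u a = - (a \<cdot> a)" and db: "dif A Y Y u b = - (b \<cdot> b)"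
      using MC by (simp_all add: eq_neg_iff_add_eq_0)
    have 1: "dif A Y Y u b \<cdot> f = - (b \<cdot> (b \<cdot> f))"
      using ob f L[of Y Y b u b] by (simp add: db comp_minus_left[of X Y Y f n _ "u + u"] comp_assoc)
    have 2: "f \<cdot> dif A X X u a = - (f \<cdot> a \<cdot> a)"
      using ob f L[of X X a u a] by (simp add: da comp_minus_right[of X X Y _ "u + u" f n] comp_assoc)
    have 3: "b \<cdot> (dif A X Y n f + b \<cdot> f - ksgn (\<sigma> u n) (f \<cdot> a))
        = b \<cdot> dif A X Y n f + b \<cdot> (b \<cdot> f) - ksgn (\<sigma> u n) (b \<cdot> f \<cdot> a)"
      using ob f Lf Rf df
      by (simp add: comp_diff_right[of X Y Y _ "n + u" _ b u] comp_add_right[of X Y Y _ "n + u" _ b u]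
          Hom_add Hom_ksgn comp_ksgn_right[of X Y Y _ "n + u" b u] comp_assoc)
    have 4: "(dif A X Y n f + b \<cdot> f - ksgn (\<sigma> u n) (f \<cdot> a)) \<cdot> a
        = dif A X Y n f \<cdot> a + b \<cdot> f \<cdot> a - ksgn (\<sigma> u n) (f \<cdot> a \<cdot> a)"
      using ob f Lf Rf df
      by (simp add: comp_diff_left[of X X Y a u _ "n + u"] comp_add_left[of X X Y a u _ "n + u"]
          Hom_add Hom_ksgn comp_ksgn_left[of X X Y a u _ "n + u"])
    show "dif ?M P Q (n + u) (dif ?M P Q n f) = 0"
      using ob f Lf Rf df
      by (simp add: unf dif_diff dif_add Hom_add Hom_ksgn dif_ksgn dif_dif dl dr 1 2 3 4
          ksgn_unit ksgn_add ksgn_diff ksgn_minus ksgn_twice)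
    assume "g \<in> Hom ?M P Q n"
    then have g: "g \<in> Hom A X Y n" by (simp add: unf)
    from ob f g show "f + g \<in> Hom ?M P Q n" by (simp add: unf Hom_add)
    from ob f g show "dif ?M P Q n (f + g) = dif ?M P Q n f + dif ?M P Q n g"
      by (simp add: unf dif_add comp_add_left[of X X Y a u] comp_add_right[of X Y Y f n g b u] ksgn_add)
  }
  {
    assume "P \<in> Ob ?M"
    then have ob: "X \<in> Ob A" "a \<in> Hom A X X u" by (auto simp: unf)
    from ob show "idm ?M P \<in> Hom ?M P P 0" by (simp add: unf idm_Hom)
    from ob show "dif ?M P P 0 (idm ?M P) = 0"
      by (simp add: unf dif_idm idm_left idm_right form_zero)
  }
  assume "P \<in> Ob ?M" "Q \<in> Ob ?M" "R' \<in> Ob ?M"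
  then have ob: "X \<in> Ob A" "Y \<in> Ob A" "Z \<in> Ob A" "a \<in> Hom A X X u" "b \<in> Hom A Y Y u" "c \<in> Hom A Z Z u"
    by (auto simp: unf)
  assume "f \<in> Hom ?M P Q n" then have f: "f \<in> Hom A X Y n" by (simp add: unf)
  {
    assume "g \<in> Hom ?M Q R' m" then have g: "g \<in> Hom A Y Z m" by (simp add: unf)
    from ob f g show "g \<cdot>\<^bsub>?M\<^esub> f \<in> Hom ?M P R' (m + n)" by (simp add: unf comp_Hom)
    have Lf: "b \<cdot> f \<in> Hom A X Y (n + u)" and Rf: "f \<cdot> a \<in> Hom A X Y (n + u)"
      and df: "dif A X Y n f \<in> Hom A X Y (n + u)" using ob f by (auto intro: L R dif_Hom)
    have Lg: "c \<cdot> g \<in> Hom A Y Z (m + u)" and Rg: "g \<cdot> b \<in> Hom A Y Z (m + u)"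
      and dg: "dif A Y Z m g \<in> Hom A Y Z (m + u)" using ob g by (auto intro: L R dif_Hom)
    have 1: "(dif A Y Z m g + c \<cdot> g - ksgn (\<sigma> u m) (g \<cdot> b)) \<cdot> f
        = dif A Y Z m g \<cdot> f + c \<cdot> (g \<cdot> f) - ksgn (\<sigma> u m) (g \<cdot> (b \<cdot> f))"
      using ob f g Lg Rg dg
      by (simp add: comp_diff_left[of X Y Z f n _ "m + u"] comp_add_left[of X Y Z f n _ "m + u"]
          Hom_add Hom_ksgn comp_ksgn_left[of X Y Z f n _ "m + u"] comp_assoc)
    have 2: "g \<cdot> (dif A X Y n f + b \<cdot> f - ksgn (\<sigma> u n) (f \<cdot> a))
        = g \<cdot> dif A X Y n f + g \<cdot> (b \<cdot> f) - ksgn (\<sigma> u n) (g \<cdot> f \<cdot> a)"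
      using ob f g Lf Rf df
      by (simp add: comp_diff_right[of X Y Z _ "n + u" _ g m] comp_add_right[of X Y Z _ "n + u" _ g m]
          Hom_add Hom_ksgn comp_ksgn_right[of X Y Z _ "n + u" g m] comp_assoc)
    show "dif ?M P R' (m + n) (g \<cdot>\<^bsub>?M\<^esub> f)
        = dif ?M Q R' m g \<cdot>\<^bsub>?M\<^esub> f + ksgn (\<sigma> u m) (g \<cdot>\<^bsub>?M\<^esub> dif ?M P Q n f)"
      using ob f g by (simp add: unf dif_comp 1 2 ksgn_form_add ksgn_add ksgn_diff)
    assume "g' \<in> Hom ?M Q R' m" then have g': "g' \<in> Hom A Y Z m" by (simp add: unf)
    from ob f g g' show "(g + g') \<cdot>\<^bsub>?M\<^esub> f = g \<cdot>\<^bsub>?M\<^esub> f + g' \<cdot>\<^bsub>?M\<^esub> f"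
      by (simp add: unf comp_add_left)
  }
  {
    assume "f' \<in> Hom ?M P Q n" "g \<in> Hom ?M Q R' m"
    with ob f show "g \<cdot>\<^bsub>?M\<^esub> (f + f') = g \<cdot>\<^bsub>?M\<^esub> f + g \<cdot>\<^bsub>?M\<^esub> f'"
      by (simp add: unf comp_add_right)
  }
  assume "S \<in> Ob ?M" "g \<in> Hom ?M Q R' m" "h \<in> Hom ?M R' S l"
  with ob f show "h \<cdot>\<^bsub>?M\<^esub> g \<cdot>\<^bsub>?M\<^esub> f = h \<cdot>\<^bsub>?M\<^esub> (g \<cdot>\<^bsub>?M\<^esub> f)"
    by (auto simp: unf comp_assoc)
qed

lemma dg_category_natural_dg: "dg_category \<sigma> u (natural_dg \<sigma> u A)"
proof unfold_locales
  let ?N = "natural_dg \<sigma> u A"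
  have unf: "Ob ?N = {(X, s). X \<in> Ob A \<and> s \<in> Hom A X X (- u) \<and> dif A X X (- u) s = idm A X \<and> s \<cdot> s = 0}"
    "\<And>X s Y t i. Hom ?N (X, s) (Y, t) i = closed_mor A X Y (- i)"
    "\<And>X s Y t i f. dif ?N (X, s) (Y, t) i f = t \<cdot> f - ksgn (\<sigma> u i) (f \<cdot> s)"
    "comp ?N = comp A" "\<And>X s. idm ?N (X, s) = idm A X"
    by (simp_all add: natural_dg_def)
  have degl: "- u + - i = - (i + u)" and deg: "- m + - n = - (m + n)" for i m n :: 'g
    by simp_all
  have L: "t \<cdot> f \<in> Hom A X Y (- (i + u))"
    if "X \<in> Ob A" "Y \<in> Ob A" "f \<in> Hom A X Y (- i)" "t \<in> Hom A Y Y (- u)"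
    for X Y f i t using comp_Hom[of X Y Y f "- i" t "- u"] that by (simp only: degl)
  have R: "f \<cdot> s \<in> Hom A X Y (- (i + u))"
    if "X \<in> Ob A" "Y \<in> Ob A" "f \<in> Hom A X Y (- i)" "s \<in> Hom A X X (- u)"
    for X Y f i s using comp_Hom[of X X Y s "- u" f "- i"] that by (simp only: deg)
  fix P Q R' S :: "'o \<times> 'm" and f g h f' g' :: 'm and n m l :: 'g
  obtain X a Y b Z c W w where [simp]: "P = (X, a)" "Q = (Y, b)" "R' = (Z, c)" "S = (W, w)"
    by (metis surj_pair)
  {
    assume "P \<in> Ob ?N" "Q \<in> Ob ?N"
    then have ob: "X \<in> Ob A" "Y \<in> Ob A" "a \<in> Hom A X X (- u)" "b \<in> Hom A Y Y (- u)"
      and da: "dif A X X (- u) a = idm A X" "dif A Y Y (- u) b = idm A Y"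
      and sq: "a \<cdot> a = 0" "b \<cdot> b = 0" by (auto simp: unf)
    from ob show "0 \<in> Hom ?N P Q n" by (simp add: unf closed_mor_def Hom_zero dif_zero)
    assume "f \<in> Hom ?N P Q n"
    then have f: "f \<in> Hom A X Y (- n)" "dif A X Y (- n) f = 0" by (simp_all add: unf closed_mor_def)
    from ob f show "- f \<in> Hom ?N P Q n" by (simp add: unf closed_mor_def Hom_minus dif_minus)
    have Lf: "b \<cdot> f \<in> Hom A X Y (- (n + u))" and Rf: "f \<cdot> a \<in> Hom A X Y (- (n + u))"
      using ob f by (blast intro: L R)+
    have 1: "dif A X Y (- (n + u)) (b \<cdot> f) = f"
      using dif_comp[of X Y Y f "- n" b "- u"] ob f
      unfolding degl by (simp add: da idm_left[of X Y f "- n"] comp_zero_right[of Y Y b "- u"])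
    have 2: "dif A X Y (- (n + u)) (f \<cdot> a) = ksgn (\<sigma> u n) f"
      using dif_comp[of X X Y a "- u" f "- n"] ob f
      unfolding deg by (simp add: da idm_right[of X Y f "- n"] comp_zero_left[of X X a "- u"] form_minus)
    from ob f Lf Rf show "dif ?N P Q n f \<in> Hom ?N P Q (n + u)"
      unfolding unf closed_mor_def \<open>P = _\<close> \<open>Q = _\<close>
      by (simp add: Hom_diff Hom_ksgn dif_diff dif_ksgn 1 2 ksgn_twice del: minus_add_distrib)
    from ob f show "idm ?N Q \<cdot>\<^bsub>?N\<^esub> f = f" by (auto simp: unf intro: idm_left)
    from ob f show "f \<cdot>\<^bsub>?N\<^esub> idm ?N P = f" by (auto simp: unf intro: idm_right)
    have 3: "b \<cdot> (b \<cdot> f - ksgn (\<sigma> u n) (f \<cdot> a)) = - ksgn (\<sigma> u n) (b \<cdot> f \<cdot> a)"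
    proof -
      have "b \<cdot> (b \<cdot> f) = 0"
        using comp_assoc[of X Y Y Y f "- n" b "- u" b "- u"] ob f
        by (simp add: sq comp_zero_left[of X Y f "- n"])
      moreover have "b \<cdot> (f \<cdot> a) = b \<cdot> f \<cdot> a"
        using comp_assoc[of X X Y Y a "- u" f "- n" b "- u"] ob f by simp
      ultimately show ?thesis
        using ob Lf Rf Hom_ksgn[OF _ _ Rf]
        by (simp only: comp_diff_right[of X Y Y _ "- (n + u)" _ b "- u"]
            comp_ksgn_right[of X Y Y _ "- (n + u)" b "- u"] diff_0)
    qed
    have 4: "(b \<cdot> f - ksgn (\<sigma> u n) (f \<cdot> a)) \<cdot> a = b \<cdot> f \<cdot> a"
    proof -
      have "f \<cdot> a \<cdot> a = 0"
        using comp_assoc[of X X X Y a "- u" a "- u" f "- n"] ob f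
        by (simp add: sq comp_zero_right[of X Y f "- n"])
      then show ?thesis
        using ob Lf Rf Hom_ksgn[OF _ _ Rf]
        by (simp only: comp_diff_left[of X X Y a "- u" _ "- (n + u)"]
            comp_ksgn_left[of X X Y a "- u" _ "- (n + u)"] ksgn_simps diff_zero)
    qed
    show "dif ?N P Q (n + u) (dif ?N P Q n f) = 0"
      by (simp add: unf 3 4 ksgn_unit)
    assume "g \<in> Hom ?N P Q n"
    then have g: "g \<in> Hom A X Y (- n)" "dif A X Y (- n) g = 0" by (simp_all add: unf closed_mor_def)
    from ob f g show "f + g \<in> Hom ?N P Q n" by (simp add: unf closed_mor_def Hom_add dif_add)
    from ob f g show "dif ?N P Q n (f + g) = dif ?N P Q n f + dif ?N P Q n g"
      by (simp add: unf comp_add_left[of X X Y a "- u" f "- n"]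
          comp_add_right[of X Y Y f "- n" g b "- u"] ksgn_add)
  }
  {
    assume "P \<in> Ob ?N"
    then have ob: "X \<in> Ob A" "a \<in> Hom A X X (- u)" by (auto simp: unf)
    from ob show "idm ?N P \<in> Hom ?N P P 0" by (simp add: unf closed_mor_def idm_Hom dif_idm)
    from ob show "dif ?N P P 0 (idm ?N P) = 0"
      by (simp add: unf form_zero idm_left[of X X a "- u"] idm_right[of X X a "- u"])
  }
  assume "P \<in> Ob ?N" "Q \<in> Ob ?N" "R' \<in> Ob ?N"
  then have ob: "X \<in> Ob A" "Y \<in> Ob A" "Z \<in> Ob A"
    "a \<in> Hom A X X (- u)" "b \<in> Hom A Y Y (- u)" "c \<in> Hom A Z Z (- u)"
    by (auto simp: unf)
  assume "f \<in> Hom ?N P Q n"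
  then have f: "f \<in> Hom A X Y (- n)" "dif A X Y (- n) f = 0" by (simp_all add: unf closed_mor_def)
  {
    assume "g \<in> Hom ?N Q R' m"
    then have g: "g \<in> Hom A Y Z (- m)" "dif A Y Z (- m) g = 0" by (simp_all add: unf closed_mor_def)
    have "g \<cdot> f \<in> Hom A X Z (- (m + n))" using comp_Hom[of X Y Z f "- n" g "- m"] ob f g by (simp only: deg)
    moreover have "dif A X Z (- (m + n)) (g \<cdot> f) = 0"
      using dif_comp[of X Y Z f "- n" g "- m"] ob f g
      unfolding deg by (simp add: comp_zero_left[of X Y f "- n"] comp_zero_right[of Y Z g "- m"])
    ultimately show "g \<cdot>\<^bsub>?N\<^esub> f \<in> Hom ?N P R' (m + n)"
      unfolding unf closed_mor_def \<open>P = _\<close> \<open>R' = _\<close> by simp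
    have Lf: "b \<cdot> f \<in> Hom A X Y (- (n + u))" and Rf: "f \<cdot> a \<in> Hom A X Y (- (n + u))"
      using ob f by (blast intro: L R)+
    have Lg: "c \<cdot> g \<in> Hom A Y Z (- (m + u))" and Rg: "g \<cdot> b \<in> Hom A Y Z (- (m + u))"
      using ob g by (blast intro: L R)+
    have 1: "(c \<cdot> g - ksgn (\<sigma> u m) (g \<cdot> b)) \<cdot> f = c \<cdot> (g \<cdot> f) - ksgn (\<sigma> u m) (g \<cdot> (b \<cdot> f))"
      using ob f g Lg Rg Hom_ksgn[OF _ _ Rg]
      by (simp only: comp_diff_left[of X Y Z f "- n" _ "- (m + u)"]
          comp_ksgn_left[of X Y Z f "- n" _ "- (m + u)"]
          comp_assoc[of X Y Z Z f "- n" g "- m" c "- u"] comp_assoc[of X Y Y Z f "- n" b "- u" g "- m"])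
    have 2: "g \<cdot> (b \<cdot> f - ksgn (\<sigma> u n) (f \<cdot> a)) = g \<cdot> (b \<cdot> f) - ksgn (\<sigma> u n) (g \<cdot> f \<cdot> a)"
      using ob f g Lf Rf Hom_ksgn[OF _ _ Rf]
      by (simp only: comp_diff_right[of X Y Z _ "- (n + u)" _ g "- m"]
          comp_ksgn_right[of X Y Z _ "- (n + u)" g "- m"]
          comp_assoc[of X X Y Z a "- u" f "- n" g "- m"])
    show "dif ?N P R' (m + n) (g \<cdot>\<^bsub>?N\<^esub> f)
        = dif ?N Q R' m g \<cdot>\<^bsub>?N\<^esub> f + ksgn (\<sigma> u m) (g \<cdot>\<^bsub>?N\<^esub> dif ?N P Q n f)"
      by (simp add: unf 1 2 ksgn_form_add ksgn_diff)
    assume "g' \<in> Hom ?N Q R' m"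
    then have "g' \<in> Hom A Y Z (- m)" by (simp add: unf closed_mor_def)
    with ob f g show "(g + g') \<cdot>\<^bsub>?N\<^esub> f = g \<cdot>\<^bsub>?N\<^esub> f + g' \<cdot>\<^bsub>?N\<^esub> f"
      by (auto simp: unf intro: comp_add_left)
  }
  {
    assume "f' \<in> Hom ?N P Q n" "g \<in> Hom ?N Q R' m"
    then have "f' \<in> Hom A X Y (- n)" "g \<in> Hom A Y Z (- m)" by (simp_all add: unf closed_mor_def)
    with ob f show "g \<cdot>\<^bsub>?N\<^esub> (f + f') = g \<cdot>\<^bsub>?N\<^esub> f + g \<cdot>\<^bsub>?N\<^esub> f'"
      by (auto simp: unf intro: comp_add_right)
  }
  assume "S \<in> Ob ?N" "g \<in> Hom ?N Q R' m" "h \<in> Hom ?N R' S l"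
  then have "W \<in> Ob A" "g \<in> Hom A Y Z (- m)" "h \<in> Hom A Z W (- l)"
    by (auto simp: unf closed_mor_def)
  with ob f show "h \<cdot>\<^bsub>?N\<^esub> g \<cdot>\<^bsub>?N\<^esub> f = h \<cdot>\<^bsub>?N\<^esub> (g \<cdot>\<^bsub>?N\<^esub> f)"
    by (auto simp: unf intro: comp_assoc)
qed

lemma idem_dg_Hom_iff:
  assumes "(X, e) \<in> Ob (idem_dg A)" "(Y, e') \<in> Ob (idem_dg A)"
  shows "f \<in> Hom (idem_dg A) (X, e) (Y, e') n \<longleftrightarrow> f \<in> Hom A X Y n \<and> e' \<cdot> f = f \<and> f \<cdot> e = f"
proof -
  have ob: "X \<in> Ob A" "Y \<in> Ob A" "e \<in> Hom A X X 0" "e' \<in> Hom A Y Y 0" "e \<cdot> e = e" "e' \<cdot> e' = e'"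
    using assms by (auto simp: idem_dg_def closed_mor_def)
  show ?thesis
  proof
    assume "f \<in> Hom (idem_dg A) (X, e) (Y, e') n"
    then obtain g where g: "g \<in> Hom A X Y n" "f = e' \<cdot> g \<cdot> e" by (auto simp: idem_dg_def)
    have eg: "e' \<cdot> g \<in> Hom A X Y n" using comp_Hom[of X Y Y g n e' 0] ob g by simp
    have ge: "g \<cdot> e \<in> Hom A X Y n" using comp_Hom[of X X Y e 0 g n] ob g by simp
    have *: "f = e' \<cdot> (g \<cdot> e)" using comp_assoc[of X X Y Y e 0 g n e' 0] ob g by simp
    show "f \<in> Hom A X Y n \<and> e' \<cdot> f = f \<and> f \<cdot> e = f"
      using comp_Hom[of X X Y e 0 "e' \<cdot> g" n] comp_assoc[of X X X Y e 0 e 0 "e' \<cdot> g" n]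
        comp_assoc[of X Y Y Y "g \<cdot> e" n e' 0 e' 0] ob g(2) eg ge *
      by simp
  next
    assume "f \<in> Hom A X Y n \<and> e' \<cdot> f = f \<and> f \<cdot> e = f"
    then show "f \<in> Hom (idem_dg A) (X, e) (Y, e') n"
      by (auto simp: idem_dg_def intro!: exI[of _ f])
  qed
qed

lemma dg_category_idem_dg: "dg_category \<sigma> u (idem_dg A)"
proof unfold_locales
  let ?I = "idem_dg A"
  have unf: "Ob ?I = {(X, e). X \<in> Ob A \<and> e \<in> closed_mor A X X 0 \<and> e \<cdot> e = e}"
    "\<And>X e Y e' n. dif ?I (X, e) (Y, e') n = dif A X Y n"
    "comp ?I = comp A" "\<And>X e. idm ?I (X, e) = e"
    by (simp_all add: idem_dg_def)
  fix P Q R' S :: "'o \<times> 'm" and f g h f' g' :: 'm and n m l :: 'g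
  obtain X a Y b Z c W w where [simp]: "P = (X, a)" "Q = (Y, b)" "R' = (Z, c)" "S = (W, w)"
    by (metis surj_pair)
  {
    assume PQ: "P \<in> Ob ?I" "Q \<in> Ob ?I"
    then have ob: "X \<in> Ob A" "Y \<in> Ob A" "a \<in> Hom A X X 0" "b \<in> Hom A Y Y 0"
      "dif A X X 0 a = 0" "dif A Y Y 0 b = 0" by (auto simp: unf closed_mor_def)
    note H = idem_dg_Hom_iff[OF PQ[unfolded \<open>P = _\<close> \<open>Q = _\<close>]]
    from ob show "0 \<in> Hom ?I P Q n" by (auto simp: H Hom_zero intro: comp_zero_left comp_zero_right)
    assume "f \<in> Hom ?I P Q n"
    then have f: "f \<in> Hom A X Y n" "b \<cdot> f = f" "f \<cdot> a = f" by (simp_all add: H)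
    from ob f show "- f \<in> Hom ?I P Q n"
      by (simp add: H Hom_minus comp_minus_left[of X X Y a 0 f n] comp_minus_right[of X Y Y f n b 0])
    from ob f show "dif ?I P Q n f \<in> Hom ?I P Q (n + u)"
      using dif_comp[of X X Y a 0 f n] dif_comp[of X Y Y f n b 0]
      by (simp add: H unf dif_Hom form_zero comp_zero_left[of X Y f n] comp_zero_right[of X Y f n])
    from f show "idm ?I Q \<cdot>\<^bsub>?I\<^esub> f = f" "f \<cdot>\<^bsub>?I\<^esub> idm ?I P = f" by (simp_all add: unf)
    from ob f show "dif ?I P Q (n + u) (dif ?I P Q n f) = 0" by (simp add: unf dif_dif)
    assume "g \<in> Hom ?I P Q n"
    then have g: "g \<in> Hom A X Y n" "b \<cdot> g = g" "g \<cdot> a = g" by (simp_all add: H)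
    from ob f g show "f + g \<in> Hom ?I P Q n"
      by (simp add: H Hom_add comp_add_left[of X X Y a 0 f n g] comp_add_right[of X Y Y f n g b 0])
    from ob f g show "dif ?I P Q n (f + g) = dif ?I P Q n f + dif ?I P Q n g"
      by (simp add: unf dif_add)
  }
  {
    assume "P \<in> Ob ?I"
    then show "idm ?I P \<in> Hom ?I P P 0" "dif ?I P P 0 (idm ?I P) = 0"
      by (auto simp: unf closed_mor_def idem_dg_Hom_iff[of X a X a])
  }
  assume PQR: "P \<in> Ob ?I" "Q \<in> Ob ?I" "R' \<in> Ob ?I"
  then have ob: "X \<in> Ob A" "Y \<in> Ob A" "Z \<in> Ob A"
    "a \<in> Hom A X X 0" "b \<in> Hom A Y Y 0" "c \<in> Hom A Z Z 0"
    by (auto simp: unf closed_mor_def)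
  note H = PQR[unfolded \<open>P = _\<close> \<open>Q = _\<close> \<open>R' = _\<close>, THEN idem_dg_Hom_iff]
  assume "f \<in> Hom ?I P Q n"
  then have f: "f \<in> Hom A X Y n" "b \<cdot> f = f" "f \<cdot> a = f" using PQR by (simp_all add: H)
  {
    assume "g \<in> Hom ?I Q R' m"
    then have g: "g \<in> Hom A Y Z m" "c \<cdot> g = g" "g \<cdot> b = g" using PQR by (simp_all add: H)
    show "g \<cdot>\<^bsub>?I\<^esub> f \<in> Hom ?I P R' (m + n)"
      using ob f g PQR comp_assoc[of X Y Z Z f n g m c 0] comp_assoc[of X X Y Z a 0 f n g m]
      by (simp add: H unf comp_Hom)
    show "dif ?I P R' (m + n) (g \<cdot>\<^bsub>?I\<^esub> f)
        = dif ?I Q R' m g \<cdot>\<^bsub>?I\<^esub> f + ksgn (\<sigma> u m) (g \<cdot>\<^bsub>?I\<^esub> dif ?I P Q n f)"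
      using ob f g by (simp add: unf dif_comp)
    assume "g' \<in> Hom ?I Q R' m"
    then have "g' \<in> Hom A Y Z m" using PQR by (simp add: H)
    with ob f g show "(g + g') \<cdot>\<^bsub>?I\<^esub> f = g \<cdot>\<^bsub>?I\<^esub> f + g' \<cdot>\<^bsub>?I\<^esub> f"
      by (auto simp: unf intro: comp_add_left)
  }
  {
    assume "f' \<in> Hom ?I P Q n" "g \<in> Hom ?I Q R' m"
    then have "f' \<in> Hom A X Y n" "g \<in> Hom A Y Z m" using PQR by (simp_all add: H)
    with ob f show "g \<cdot>\<^bsub>?I\<^esub> (f + f') = g \<cdot>\<^bsub>?I\<^esub> f + g \<cdot>\<^bsub>?I\<^esub> f'"
      by (auto simp: unf intro: comp_add_right)
  }
  assume S: "S \<in> Ob ?I" and gh: "g \<in> Hom ?I Q R' m" "h \<in> Hom ?I R' S l"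
  then have "W \<in> Ob A" "g \<in> Hom A Y Z m" "h \<in> Hom A Z W l"
    using PQR by (auto simp: H unf idem_dg_Hom_iff[of Z c W w])
  with ob f show "h \<cdot>\<^bsub>?I\<^esub> g \<cdot>\<^bsub>?I\<^esub> f = h \<cdot>\<^bsub>?I\<^esub> (g \<cdot>\<^bsub>?I\<^esub> f)"
    by (auto simp: unf intro: comp_assoc)
qed

lemma dg_equivalence_idem_embedding:
  "dg_equivalence u A (full_dg_subcat (idem_dg A) (idem_embedding_obs A)) (\<lambda>X. (X, idm A X)) (\<lambda>X Y n f. f)"
proof -
  have ob: "(X, idm A X) \<in> Ob (idem_dg A)" if "X \<in> Ob A" for X
    using that idm_Hom idm_left[of X X "idm A X" 0] by (auto simp: idem_dg_def closed_mor_def dif_idm)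
  have H: "Hom (idem_dg A) (X, idm A X) (Y, idm A Y) n = Hom A X Y n" if "X \<in> Ob A" "Y \<in> Ob A" for X Y n
    using that idm_left[of X Y] idm_right[of X Y] by (auto simp: idem_dg_Hom_iff[OF ob ob])
  have iso: "isomorphic_in (Z0 (full_dg_subcat (idem_dg A) (idem_embedding_obs A))) (X, idm A X) (X, idm A X)"
    if "X \<in> Ob A" for X
    using that H[of X X 0] idm_Hom[of X] idm_left[of X X "idm A X" 0] dif_idm[of X]
    by (auto simp: isomorphic_in_def Z0_def full_dg_subcat_def closed_mor_def idem_dg_def)
  have unf: "comp (idem_dg A) = comp A" "\<And>P Q n. dif (idem_dg A) P Q n = dif A (fst P) (fst Q) n"
    "\<And>P. idm (idem_dg A) P = snd P"
    by (auto simp: idem_dg_def split: prod.splits)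
  show ?thesis
    unfolding dg_equivalence_def dg_functor_def
    using iso by (auto simp: full_dg_subcat_def idem_embedding_obs_def H unf bij_betw_def)
qed

end

end

theory Submission
  imports Defs
begin

text \<open>
  An object of the twofold construction is an object \<open>X\<close> of \<open>A\<close> with two endomorphisms: \<open>s\<close> of degree \<open>-1\<close>
  with \<open>d s = id\<close>, \<open>s\<^sup>2 = 0\<close>, and a closed \<open>t\<close> of degree \<open>1\<close> with \<open>t\<^sup>2 = 0\<close>, \<open>s t + t s = id\<close>. Thus
  \<open>s t\<close> and \<open>t s\<close> are complementary idempotents, in general not closed: \<open>d(t s) = - t\<close>. They become closed
  once the differential is twisted by the Maurer--Cartan element \<open>- t\<close>, and so \<open>X\<close> yields the object
  \<open>((X, - t), t s)\<close> of the idempotent completion of the twist completion.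

  This assignment is fully faithful. A morphism \<open>f\<close> of degree \<open>n\<close> of the twofold construction is a closed
  morphism that commutes with the \<open>s\<close>, up to sign, and it goes to \<open>\<plusminus> t' s' f\<close>. Conversely \<open>f\<close> is recovered
  from \<open>g = t' s' f\<close>, because \<open>d g = - t' f\<close> and hence \<open>f = t' s' f + s' t' f = g - s' d g\<close>
  (\<open>to_idem_mc_fully_faithful\<close>).

  Every twisted object \<open>(X, a)\<close> is reached, up to isomorphism (\<open>mc_object_in_image\<close>). On the cone \<open>C\<close> of
  \<open>id\<^sub>X\<close>, which as a graded object is \<open>X[1] \<oplus> X\<close>, the contracting homotopy is an \<open>s\<close>, and a suitable \<open>t\<close>
  built from \<open>a\<close> makes \<open>t s\<close> a projector whose image in the twist completion is \<open>(X, a)\<close>. So the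
  closure of the image under isomorphisms is an intermediate full DG-subcategory.

  If idempotents split in \<open>Z\<^sup>0(A)\<close>, they split in \<open>Z\<^sup>0\<close> of the once, hence also of the twofold
  construction (\<open>natural_idempotents_split\<close>): \<open>s\<close> restricts to the image of an idempotent that commutes with
  it. A fully faithful functor out of a category with split idempotents has an image closed under
  retracts, up to isomorphism (\<open>fully_faithful_retract\<close>). Every object of the idempotent completion is a retract of some
  \<open>((X, a), id)\<close>, which is isomorphic to an object of the image; so the closure is everything.
\<close>

section \<open>Calculus of morphisms\<close>

lemma dg_functorD:
  assumes "dg_functor u A B F \<phi>" and "X \<in> Ob A" "Y \<in> Ob A"
  shows "F X \<in> Ob B"
    and "f \<in> Hom A X Y n \<Longrightarrow> \<phi> X Y n f \<in> Hom B (F X) (F Y) n"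
    and "\<lbrakk>f \<in> Hom A X Y n; g \<in> Hom A X Y n\<rbrakk> \<Longrightarrow> \<phi> X Y n (f + g) = \<phi> X Y n f + \<phi> X Y n g"
    and "f \<in> Hom A X Y n \<Longrightarrow> \<phi> X Y (n + u) (dif A X Y n f) = dif B (F X) (F Y) n (\<phi> X Y n f)"
    and "\<lbrakk>Z \<in> Ob A; f \<in> Hom A X Y n; g \<in> Hom A Y Z m\<rbrakk>
      \<Longrightarrow> \<phi> X Z (m + n) (g \<cdot>\<^bsub>A\<^esub> f) = \<phi> Y Z m g \<cdot>\<^bsub>B\<^esub> \<phi> X Y n f"
    and "\<phi> X X 0 (idm A X) = idm B (F X)"
  using assms unfolding dg_functor_def by simp_all

context dg_category
begin

text \<open>
  Bundling the membership of the objects with that of the morphism lets the facts about the factors of a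
  composite determine all parameters of a rule when they are plugged in with \<open>OF\<close>. Where a degree is a
  sum, it is a variable \<open>k\<close> with an equation as premise, so that sums such as \<open>u + - u\<close> can be simplified.
\<close>

definition mor :: "'o \<Rightarrow> 'o \<Rightarrow> 'g \<Rightarrow> 'm \<Rightarrow> bool" where
  "mor X Y n f \<longleftrightarrow> X \<in> Ob A \<and> Y \<in> Ob A \<and> f \<in> Hom A X Y n"

lemma mor_idm: "X \<in> Ob A \<Longrightarrow> mor X X 0 (idm A X)"
  by (simp add: mor_def idm_Hom)

lemma mor_comp: "\<lbrakk>mor X Y n f; mor Y Z m g; k = m + n\<rbrakk> \<Longrightarrow> mor X Z k (g \<cdot> f)"
  by (auto simp: mor_def comp_Hom)

lemma mor_dif: "\<lbrakk>mor X Y n f; k = n + u\<rbrakk> \<Longrightarrow> mor X Y k (dif A X Y n f)"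
  by (auto simp: mor_def dif_Hom)

lemma mor_add: "\<lbrakk>mor X Y n f; mor X Y n g\<rbrakk> \<Longrightarrow> mor X Y n (f + g)"
  by (auto simp: mor_def Hom_add)

lemma mor_diff: "\<lbrakk>mor X Y n f; mor X Y n g\<rbrakk> \<Longrightarrow> mor X Y n (f - g)"
  by (auto simp: mor_def Hom_diff)

lemma mor_minus: "mor X Y n f \<Longrightarrow> mor X Y n (- f)"
  by (auto simp: mor_def Hom_minus)

lemma mor_ksgn: "mor X Y n f \<Longrightarrow> mor X Y n (ksgn \<epsilon> f)"
  by (auto simp: mor_def Hom_ksgn)

lemma mor_assoc: "\<lbrakk>mor W X n f; mor X Y m g; mor Y Z l h\<rbrakk> \<Longrightarrow> h \<cdot> g \<cdot> f = h \<cdot> (g \<cdot> f)"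
  by (auto simp: mor_def comp_assoc)

lemma mor_idm_left: "mor X Y n f \<Longrightarrow> idm A Y \<cdot> f = f"
  by (auto simp: mor_def idm_left)

lemma mor_idm_right: "mor X Y n f \<Longrightarrow> f \<cdot> idm A X = f"
  by (auto simp: mor_def idm_right)

lemma mor_zero: "mor X Y n f \<Longrightarrow> 0 \<cdot> f = 0" "mor X Y n f \<Longrightarrow> f \<cdot> 0 = 0"
  by (auto simp: mor_def comp_zero_left comp_zero_right)

lemma mor_add_left: "\<lbrakk>mor X Y n f; mor Y Z m g; mor Y Z m h\<rbrakk> \<Longrightarrow> (g + h) \<cdot> f = g \<cdot> f + h \<cdot> f"
  by (auto simp: mor_def comp_add_left)

lemma mor_add_right: "\<lbrakk>mor X Y n f; mor X Y n h; mor Y Z m g\<rbrakk> \<Longrightarrow> g \<cdot> (f + h) = g \<cdot> f + g \<cdot> h"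
  by (auto simp: mor_def comp_add_right)

lemma mor_diff_left: "\<lbrakk>mor X Y n f; mor Y Z m g; mor Y Z m h\<rbrakk> \<Longrightarrow> (g - h) \<cdot> f = g \<cdot> f - h \<cdot> f"
  by (auto simp: mor_def comp_diff_left)

lemma mor_diff_right: "\<lbrakk>mor X Y n f; mor X Y n h; mor Y Z m g\<rbrakk> \<Longrightarrow> g \<cdot> (f - h) = g \<cdot> f - g \<cdot> h"
  by (auto simp: mor_def comp_diff_right)

lemma mor_minus_left: "\<lbrakk>mor X Y n f; mor Y Z m g\<rbrakk> \<Longrightarrow> (- g) \<cdot> f = - (g \<cdot> f)"
  by (auto simp: mor_def comp_minus_left)

lemma mor_minus_right: "\<lbrakk>mor X Y n f; mor Y Z m g\<rbrakk> \<Longrightarrow> g \<cdot> (- f) = - (g \<cdot> f)"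
  by (auto simp: mor_def comp_minus_right)

lemma mor_ksgn_left: "\<lbrakk>mor X Y n f; mor Y Z m g\<rbrakk> \<Longrightarrow> ksgn \<epsilon> g \<cdot> f = ksgn \<epsilon> (g \<cdot> f)"
  by (auto simp: mor_def comp_ksgn_left)

lemma mor_ksgn_right: "\<lbrakk>mor X Y n f; mor Y Z m g\<rbrakk> \<Longrightarrow> g \<cdot> ksgn \<epsilon> f = ksgn \<epsilon> (g \<cdot> f)"
  by (auto simp: mor_def comp_ksgn_right)

lemma mor_dif_comp: "\<lbrakk>mor X Y n f; mor Y Z m g; k = m + n\<rbrakk>
    \<Longrightarrow> dif A X Z k (g \<cdot> f) = dif A Y Z m g \<cdot> f + ksgn (\<sigma> u m) (g \<cdot> dif A X Y n f)"
  by (auto simp: mor_def dif_comp)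

lemma mor_dif_dif: "\<lbrakk>mor X Y n f; k = n + u\<rbrakk> \<Longrightarrow> dif A X Y k (dif A X Y n f) = 0"
  by (auto simp: mor_def dif_dif)

lemma mor_dif_add: "\<lbrakk>mor X Y n f; mor X Y n g\<rbrakk> \<Longrightarrow> dif A X Y n (f + g) = dif A X Y n f + dif A X Y n g"
  by (auto simp: mor_def dif_add)

lemma mor_dif_diff: "\<lbrakk>mor X Y n f; mor X Y n g\<rbrakk> \<Longrightarrow> dif A X Y n (f - g) = dif A X Y n f - dif A X Y n g"
  by (auto simp: mor_def dif_diff)

lemma mor_dif_minus: "mor X Y n f \<Longrightarrow> dif A X Y n (- f) = - dif A X Y n f"
  by (auto simp: mor_def dif_minus)

lemma mor_dif_ksgn: "mor X Y n f \<Longrightarrow> dif A X Y n (ksgn \<epsilon> f) = ksgn \<epsilon> (dif A X Y n f)"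
  by (auto simp: mor_def dif_ksgn)

lemma closed_mor_comp:
  assumes "X \<in> Ob A" "Y \<in> Ob A" "Z \<in> Ob A" "f \<in> closed_mor A X Y n" "g \<in> closed_mor A Y Z m"
  shows "g \<cdot> f \<in> closed_mor A X Z (m + n)"
proof -
  have "mor X Y n f" "mor Y Z m g" using assms by (auto simp: mor_def closed_mor_def)
  then show ?thesis
    using mor_comp[of X Y n f Z m g] mor_dif_comp[of X Y n f Z m g] assms(4,5)
    by (auto simp: closed_mor_def mor_def mor_zero)
qed

section \<open>The twofold construction and the completion, unfolded\<close>

abbreviation natnat :: "(('o \<times> 'm) \<times> 'm, 'g, 'm) dgcat" where
  "natnat \<equiv> natural_dg \<sigma> u (natural_dg \<sigma> u A)"

abbreviation mc_idem :: "(('o \<times> 'm) \<times> 'm, 'g, 'm) dgcat" where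
  "mc_idem \<equiv> idem_dg (mc_dg \<sigma> u A)"

text \<open>
  A morphism of degree \<open>i\<close> of the natural construction is a morphism of degree \<open>- i\<close> below. Hence the second
  contracting homotopy \<open>t\<close> has degree \<open>u\<close> in \<open>A\<close>, and the condition on its differential is the
  anticommutation with \<open>s\<close>; its being closed in \<open>A\<close> is part of its being a morphism.
\<close>

lemma natural_natural_Ob:
  "((X, s), t) \<in> Ob natnat \<longleftrightarrow>
     mor X X (- u) s \<and> mor X X u t \<and> dif A X X (- u) s = idm A X \<and> dif A X X u t = 0 \<and>
     s \<cdot> s = 0 \<and> t \<cdot> t = 0 \<and> s \<cdot> t + t \<cdot> s = idm A X"
  by (auto simp: natural_dg_def closed_mor_def mor_def form_minus form_unit)

lemma natural_natural_Hom:
  assumes "((X, s), t) \<in> Ob natnat"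
    and "((Y, s'), t') \<in> Ob natnat"
  shows "f \<in> Hom natnat ((X, s), t) ((Y, s'), t') n \<longleftrightarrow>
     mor X Y n f \<and> dif A X Y n f = 0 \<and> s' \<cdot> f = ksgn (\<sigma> u n) (f \<cdot> s)"
  using assms by (auto simp: natural_dg_def closed_mor_def mor_def form_minus)

lemma natural_natural_simps:
  "dif natnat ((X, s), t) ((Y, s'), t') n f = t' \<cdot> f - ksgn (\<sigma> u n) (f \<cdot> t)"
  "comp natnat = comp A"
  "idm natnat ((X, s), t) = idm A X"
  by (simp_all add: natural_dg_def)

lemma idem_mc_Ob:
  "((X, a), e) \<in> Ob mc_idem \<longleftrightarrow>
     mor X X u a \<and> dif A X X u a + a \<cdot> a = 0 \<and>
     mor X X 0 e \<and> dif A X X 0 e + a \<cdot> e - e \<cdot> a = 0 \<and> e \<cdot> e = e"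
  by (auto simp: idem_dg_def mc_dg_def closed_mor_def mor_def form_zero)

lemma idem_mc_Hom:
  assumes "((X, a), e) \<in> Ob mc_idem"
    and "((Y, b), e') \<in> Ob mc_idem"
  shows "f \<in> Hom mc_idem ((X, a), e) ((Y, b), e') n \<longleftrightarrow>
     mor X Y n f \<and> e' \<cdot> f = f \<and> f \<cdot> e = f"
proof -
  interpret M: dg_category \<sigma> u "mc_dg \<sigma> u A" by (rule dg_category_mc_dg)
  have "X \<in> Ob A" "Y \<in> Ob A" using assms by (auto simp: idem_mc_Ob mor_def)
  then show ?thesis
    by (subst M.idem_dg_Hom_iff[OF assms]) (auto simp: mor_def mc_dg_def)
qed

lemma idem_mc_simps:
  "dif mc_idem ((X, a), e) ((Y, b), e') n f
     = dif A X Y n f + b \<cdot> f - ksgn (\<sigma> u n) (f \<cdot> a)"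
  "comp mc_idem = comp A"
  "idm mc_idem ((X, a), e) = e"
  by (simp_all add: idem_dg_def mc_dg_def)

text \<open>
  The relations between \<open>s\<close> and \<open>t\<close> are those of matrix units: \<open>t s\<close> and \<open>s t\<close> are complementary
  idempotents, and \<open>s\<close> and \<open>t\<close> interchange their images.
\<close>

lemma natural_natural_rules:
  assumes "((X, s), t) \<in> Ob natnat"
  shows "mor X X (- u) s" "mor X X u t" "mor X X 0 (t \<cdot> s)" "mor X X 0 (s \<cdot> t)"
    and "t \<cdot> s \<cdot> t = t" "t \<cdot> s \<cdot> (t \<cdot> s) = t \<cdot> s" "s \<cdot> (t \<cdot> s) = s"
    and "t \<cdot> (t \<cdot> s) = 0" "t \<cdot> s \<cdot> s = 0"
    and "dif A X X 0 (t \<cdot> s) = - t"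
proof -
  note P = assms[unfolded natural_natural_Ob]
  show s: "mor X X (- u) s" and t: "mor X X u t" using P by blast+
  then have X: "X \<in> Ob A" by (simp add: mor_def)
  show ts: "mor X X 0 (t \<cdot> s)" and st: "mor X X 0 (s \<cdot> t)"
    using mor_comp[OF s t] mor_comp[OF t s] by auto
  have ts': "t \<cdot> s = idm A X - s \<cdot> t" and st': "s \<cdot> t = idm A X - t \<cdot> s"
    using P by (auto simp: algebra_simps)
  have tts: "t \<cdot> (t \<cdot> s) = 0"
    using mor_assoc[OF s t t] P by (simp add: mor_zero[OF s])
  show tst: "t \<cdot> s \<cdot> t = t"
    unfolding mor_assoc[OF t s t] st' mor_diff_right[OF mor_idm[OF X] ts t] tts
    by (simp add: mor_idm_right[OF t])
  then show "t \<cdot> s \<cdot> (t \<cdot> s) = t \<cdot> s" using mor_assoc[OF s t ts] by simp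
  have sst: "s \<cdot> (s \<cdot> t) = 0"
    using mor_assoc[OF t s s] P by (simp add: mor_zero[OF t])
  show "s \<cdot> (t \<cdot> s) = s"
    unfolding ts' mor_diff_right[OF mor_idm[OF X] st s] sst by (simp add: mor_idm_right[OF s])
  show "t \<cdot> (t \<cdot> s) = 0" by (rule tts)
  show "t \<cdot> s \<cdot> s = 0" using mor_assoc[OF s s t] P by (simp add: mor_zero[OF t])
  show "dif A X X 0 (t \<cdot> s) = - t"
    using mor_dif_comp[OF s t] P by (simp add: mor_zero[OF s] mor_idm_right[OF t] form_unit)
qed

text \<open>
  The sign of \<open>- t\<close> is forced: \<open>t (t s) - (t s) t = - t\<close> is also the value of \<open>d(t s)\<close>, so twisting by
  \<open>- t\<close> cancels it, whereas twisting by \<open>t\<close> would double it.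
\<close>

lemma natural_natural_image_Ob:
  assumes "((X, s), t) \<in> Ob natnat"
  shows "((X, - t), t \<cdot> s) \<in> Ob mc_idem"
proof -
  note R = natural_natural_rules[OF assms]
  show ?thesis
    using assms unfolding idem_mc_Ob natural_natural_Ob
    by (simp add: R mor_minus mor_dif_minus mor_minus_left[OF mor_minus[OF R(2)] R(2)]
        mor_minus_left[OF R(2) R(2)] mor_minus_right[OF R(2) R(2)] mor_minus_left[OF R(3) R(2)]
        mor_minus_right[OF R(2) R(3)])
qed

text \<open>
  Moving \<open>s\<close> across \<open>f\<close> and using \<open>s t s = s\<close> gives \<open>t' s' f t s = t' s' f\<close>: such an \<open>f\<close> maps the kernel of
  \<open>t s\<close> to that of \<open>t' s'\<close>, so cutting down by \<open>t' s'\<close> on the left suffices. This also makes \<open>f \<mapsto> t' s' f\<close>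
  multiplicative.
\<close>

lemma natural_natural_mor_rules:
  assumes P: "((X, s), t) \<in> Ob natnat"
    and Q: "((Y, s'), t') \<in> Ob natnat"
    and F: "f \<in> Hom natnat ((X, s), t) ((Y, s'), t') n"
  shows "mor X Y n f" "mor X Y n (t' \<cdot> s' \<cdot> f)"
    and "t' \<cdot> s' \<cdot> (t' \<cdot> s' \<cdot> f) = t' \<cdot> s' \<cdot> f" "t' \<cdot> s' \<cdot> f \<cdot> (t \<cdot> s) = t' \<cdot> s' \<cdot> f"
    and "dif A X Y n (t' \<cdot> s' \<cdot> f) = - (t' \<cdot> f)"
proof -
  note R = natural_natural_rules[OF P] and R' = natural_natural_rules[OF Q]
  show f: "mor X Y n f" using F natural_natural_Hom[OF P Q] by simp
  have df: "dif A X Y n f = 0" and sf: "s' \<cdot> f = ksgn (\<sigma> u n) (f \<cdot> s)"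
    using F natural_natural_Hom[OF P Q] by simp_all
  show "mor X Y n (t' \<cdot> s' \<cdot> f)" using mor_comp[OF f R'(3)] by simp
  show "t' \<cdot> s' \<cdot> (t' \<cdot> s' \<cdot> f) = t' \<cdot> s' \<cdot> f"
    using mor_assoc[OF f R'(3) R'(3)] R'(6) by simp
  have fs: "mor X Y (n - u) (f \<cdot> s)" using mor_comp[OF R(1) f] by simp
  have "t' \<cdot> s' \<cdot> f \<cdot> (t \<cdot> s) = t' \<cdot> ((s' \<cdot> f) \<cdot> (t \<cdot> s))"
    using mor_assoc[OF f R'(1,2)] mor_assoc[OF R(3) mor_comp[OF f R'(1) refl] R'(2)] by simp
  also have "(s' \<cdot> f) \<cdot> (t \<cdot> s) = s' \<cdot> f"
    unfolding sf mor_ksgn_left[OF R(3) fs] mor_assoc[OF R(3) R(1) f] R(7) ..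
  finally show "t' \<cdot> s' \<cdot> f \<cdot> (t \<cdot> s) = t' \<cdot> s' \<cdot> f"
    using mor_assoc[OF f R'(1,2)] by simp
  show "dif A X Y n (t' \<cdot> s' \<cdot> f) = - (t' \<cdot> f)"
    using mor_dif_comp[OF f R'(3)] by (simp add: df R' mor_zero[OF R'(3)] mor_minus_left[OF f R'(2)])
qed

section \<open>The fully faithful functor\<close>

definition to_idem_mc :: "('o \<times> 'm) \<times> 'm \<Rightarrow> ('o \<times> 'm) \<times> 'm" where
  "to_idem_mc = (\<lambda>((X, s), t). ((X, - t), t \<cdot> s))"

text \<open>
  Without the sign \<open>(-1)\<^sup>n\<close>, the map \<open>f \<mapsto> t' s' f\<close> would anticommute with the differentials, since the
  twist is by \<open>- t\<close>. The sign is multiplicative in \<open>n\<close>, so it does not affect composition.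
\<close>

definition to_idem_mc_mor ::
    "('o \<times> 'm) \<times> 'm \<Rightarrow> ('o \<times> 'm) \<times> 'm \<Rightarrow> 'g \<Rightarrow> 'm \<Rightarrow> 'm" where
  "to_idem_mc_mor P Q n f = ksgn (\<sigma> u n) (snd (to_idem_mc Q) \<cdot> f)"

lemma dg_functor_to_idem_mc:
  "dg_functor u natnat mc_idem to_idem_mc to_idem_mc_mor"
proof -
  have ob: "to_idem_mc P \<in> Ob mc_idem" if "P \<in> Ob natnat" for P
    using that natural_natural_image_Ob by (cases P; cases "fst P") (auto simp: to_idem_mc_def)
  have hom: "to_idem_mc_mor P Q n f \<in> Hom mc_idem (to_idem_mc P) (to_idem_mc Q) n"
    and add: "g \<in> Hom natnat P Q n \<Longrightarrow>
      to_idem_mc_mor P Q n (f + g) = to_idem_mc_mor P Q n f + to_idem_mc_mor P Q n g"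
    and dif: "to_idem_mc_mor P Q (n + u) (dif natnat P Q n f)
      = dif mc_idem (to_idem_mc P) (to_idem_mc Q) n (to_idem_mc_mor P Q n f)"
    if PQ: "P \<in> Ob natnat" "Q \<in> Ob natnat" and f: "f \<in> Hom natnat P Q n" for P Q n f g
  proof -
    obtain X s t Y s' t' where [simp]: "P = ((X, s), t)" "Q = ((Y, s'), t')" by (metis surj_pair)
    note PQ' = PQ[simplified] and f' = f[simplified]
    note R = natural_natural_rules[OF PQ'(1)] and R' = natural_natural_rules[OF PQ'(2)]
      and F = natural_natural_mor_rules[OF PQ' f']
    show "to_idem_mc_mor P Q n f \<in> Hom mc_idem (to_idem_mc P) (to_idem_mc Q) n"
      by (simp add: to_idem_mc_mor_def to_idem_mc_def idem_mc_Hom natural_natural_image_Ob PQ' F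
          mor_ksgn mor_ksgn_left[OF R(3) F(2)] mor_ksgn_right[OF F(2) R'(3)])
    show "to_idem_mc_mor P Q n (f + g) = to_idem_mc_mor P Q n f + to_idem_mc_mor P Q n g"
      if "g \<in> Hom natnat P Q n"
      using that PQ' by (simp add: natural_natural_Hom to_idem_mc_mor_def to_idem_mc_def
          mor_add_right[OF F(1) _ R'(3)] ksgn_add)
    have tf: "mor X Y (n + u) (t' \<cdot> f)" and ft: "mor X Y (n + u) (f \<cdot> t)"
      using mor_comp[OF F(1) R'(2)] mor_comp[OF R(2) F(1)] by (simp_all add: add.commute)
    \<comment> \<open>Both sides of the compatibility with differentials are brought to one normal form.\<close>
    have "dif mc_idem (to_idem_mc P) (to_idem_mc Q) n (to_idem_mc_mor P Q n f)
        = ksgn (\<sigma> u n) (- (t' \<cdot> f) + ksgn (\<sigma> u n) (t' \<cdot> s' \<cdot> f \<cdot> t))"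
      using mor_assoc[OF F(1) R'(3) R'(2)]
      by (simp add: to_idem_mc_mor_def to_idem_mc_def idem_mc_simps mor_dif_ksgn[OF F(2)] F(5)
          mor_ksgn_left[OF mor_minus[OF R(2)] F(2)] mor_minus_right[OF R(2) F(2)]
          mor_minus_left[OF mor_ksgn[OF F(2)] R'(2)] mor_ksgn_right[OF F(2) R'(2)] R'(8)
          mor_zero[OF F(1)] ksgn_add ksgn_diff ksgn_minus ksgn_twice)
    moreover have "to_idem_mc_mor P Q (n + u) (dif natnat P Q n f)
        = ksgn (\<sigma> u n) (- (t' \<cdot> f) + ksgn (\<sigma> u n) (t' \<cdot> s' \<cdot> f \<cdot> t))"
      using mor_assoc[OF F(1) R'(2) R'(3)] mor_assoc[OF R(2) F(1) R'(3)]
      by (simp add: to_idem_mc_mor_def to_idem_mc_def natural_natural_simps R'(5) ksgn_unit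
          mor_diff_right[OF tf mor_ksgn[OF ft] R'(3)] mor_ksgn_right[OF ft R'(3)]
          ksgn_add ksgn_diff ksgn_minus ksgn_twice)
    ultimately show "to_idem_mc_mor P Q (n + u) (dif natnat P Q n f)
      = dif mc_idem (to_idem_mc P) (to_idem_mc Q) n (to_idem_mc_mor P Q n f)" by simp
  qed
  have comp: "to_idem_mc_mor P R (m + n) (g \<cdot> f) = to_idem_mc_mor Q R m g \<cdot> to_idem_mc_mor P Q n f"
    if PQR: "P \<in> Ob natnat" "Q \<in> Ob natnat" "R \<in> Ob natnat"
      and f: "f \<in> Hom natnat P Q n" and g: "g \<in> Hom natnat Q R m"
    for P Q R n m f g
  proof -
    obtain X s t Y s' t' Z s'' t'' where
      [simp]: "P = ((X, s), t)" "Q = ((Y, s'), t')" "R = ((Z, s''), t'')" by (metis surj_pair)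
    note PQR' = PQR[simplified]
    note R' = natural_natural_rules[OF PQR'(2)] and R'' = natural_natural_rules[OF PQR'(3)]
      and F = natural_natural_mor_rules[OF PQR'(1,2) f[simplified]]
      and G = natural_natural_mor_rules[OF PQR'(2,3) g[simplified]]
    show ?thesis
      using mor_assoc[OF F(1) R'(3) G(2)] mor_assoc[OF F(1) G(1) R''(3)]
      by (simp add: to_idem_mc_mor_def to_idem_mc_def G(4) ksgn_form_add
          mor_ksgn_left[OF mor_ksgn[OF F(2)] G(2)] mor_ksgn_right[OF F(2) G(2)])
  qed
  have idm: "to_idem_mc_mor P P 0 (idm natnat P) = idm mc_idem (to_idem_mc P)" if P: "P \<in> Ob natnat" for P
  proof -
    obtain X s t where [simp]: "P = ((X, s), t)" by (metis surj_pair)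
    show ?thesis
      using natural_natural_rules(3)[OF P[simplified]]
      by (simp add: to_idem_mc_mor_def to_idem_mc_def natural_natural_simps idem_mc_simps form_zero
          mor_idm_right)
  qed
  show ?thesis
    unfolding dg_functor_def natural_natural_simps(2) idem_mc_simps(2)
    using ob hom add dif comp idm by (intro conjI ballI allI) blast+
qed

text \<open>
  The inverse is \<open>g \<mapsto> \<plusminus> (g - s' d g)\<close>. Its value is closed because \<open>d s' = id\<close>, and it is compatible with
  the \<open>s\<close> because \<open>g s = g (t s) s = 0\<close>, whose differential gives \<open>d g s = \<mp> g\<close>.
\<close>

lemma to_idem_mc_fully_faithful:
  assumes PQ: "P \<in> Ob natnat" "Q \<in> Ob natnat"
  shows "bij_betw (to_idem_mc_mor P Q n) (Hom natnat P Q n)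
    (Hom mc_idem (to_idem_mc P) (to_idem_mc Q) n)"
proof -
  obtain X s t Y s' t' where [simp]: "P = ((X, s), t)" "Q = ((Y, s'), t')" by (metis surj_pair)
  note PQ' = PQ[simplified]
  note R = natural_natural_rules[OF PQ'(1)] and R' = natural_natural_rules[OF PQ'(2)]
  have ds: "dif A X X (- u) s = idm A X" "dif A Y Y (- u) s' = idm A Y"
    and sum: "s' \<cdot> t' + t' \<cdot> s' = idm A Y" and ss: "s' \<cdot> s' = 0"
    using PQ' by (simp_all add: natural_natural_Ob)
  define inv where "inv g = ksgn (\<sigma> u n) (g - s' \<cdot> dif A X Y n g)" for g
  show ?thesis
  proof (rule bij_betw_byWitness[where f' = inv]; safe?)
    fix f assume f: "f \<in> Hom natnat P Q n"
    note F = natural_natural_mor_rules[OF PQ' f[simplified]]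
    have tf: "mor X Y (n + u) (t' \<cdot> f)" using mor_comp[OF F(1) R'(2)] by (simp add: add.commute)
    have "s' \<cdot> (t' \<cdot> f) + t' \<cdot> s' \<cdot> f = f"
      using mor_idm_left[OF F(1)] mor_add_left[OF F(1) R'(4,3)] mor_assoc[OF F(1) R'(2,1)] sum by simp
    then show "inv (to_idem_mc_mor P Q n f) = f"
      by (simp add: inv_def to_idem_mc_mor_def to_idem_mc_def mor_dif_ksgn[OF F(2)] F(5)
          mor_ksgn_right[OF tf R'(1)] mor_minus_right[OF mor_ksgn[OF tf] R'(1)]
          ksgn_add ksgn_diff ksgn_minus ksgn_twice add.commute)
    show "to_idem_mc_mor P Q n f \<in> Hom mc_idem (to_idem_mc P) (to_idem_mc Q) n"
      using dg_functorD(2)[OF dg_functor_to_idem_mc PQ f] .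
  next
    fix g assume "g \<in> Hom mc_idem (to_idem_mc P) (to_idem_mc Q) n"
    then have g: "mor X Y n g" and eg: "t' \<cdot> s' \<cdot> g = g" and ge: "g \<cdot> (t \<cdot> s) = g"
      by (simp_all add: to_idem_mc_def idem_mc_Hom natural_natural_image_Ob PQ')
    note dg = mor_dif[OF g refl]
    have sdg: "mor X Y n (s' \<cdot> dif A X Y n g)" using mor_comp[OF dg R'(1)] by simp
    show "to_idem_mc_mor P Q n (inv g) = g"
      using mor_assoc[OF dg R'(1,3)]
      by (simp add: to_idem_mc_mor_def to_idem_mc_def inv_def mor_ksgn_right[OF mor_diff[OF g sdg] R'(3)]
          mor_diff_right[OF g sdg R'(3)] eg R'(9) mor_zero[OF dg] ksgn_twice)
    have closed: "dif A X Y n (inv g) = 0"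
      using mor_dif_comp[OF dg R'(1)]
      by (simp add: inv_def mor_dif_ksgn[OF mor_diff[OF g sdg]] mor_dif_diff[OF g sdg] ds
          mor_dif_dif[OF g] mor_idm_left[OF dg] mor_zero[OF R'(1)])
    have gs: "g \<cdot> s = 0"
      using mor_assoc[OF R(1) R(3) g] by (simp add: ge R(9) mor_zero[OF g])
    have "0 = dif A X Y (n - u) (g \<cdot> s)" using gs dif_zero g by (simp add: mor_def)
    also have "\<dots> = dif A X Y n g \<cdot> s + ksgn (\<sigma> u n) g"
      using mor_dif_comp[OF R(1) g] by (simp add: ds mor_idm_right[OF g])
    finally have dgs: "dif A X Y n g \<cdot> s = - ksgn (\<sigma> u n) g"
      by (simp add: eq_neg_iff_add_eq_0)
    have "s' \<cdot> inv g = ksgn (\<sigma> u n) (s' \<cdot> g)"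
      using mor_assoc[OF dg R'(1,1)]
      by (simp add: inv_def mor_ksgn_right[OF mor_diff[OF g sdg] R'(1)] mor_diff_right[OF g sdg R'(1)]
          ss mor_zero[OF dg])
    moreover have "inv g \<cdot> s = s' \<cdot> g"
      using mor_assoc[OF R(1) dg R'(1)]
      by (simp add: inv_def mor_ksgn_left[OF R(1) mor_diff[OF g sdg]] mor_diff_left[OF R(1) g sdg]
          gs dgs mor_minus_right[OF mor_ksgn[OF g] R'(1)] mor_ksgn_right[OF g R'(1)] ksgn_twice ksgn_minus)
    ultimately show "inv g \<in> Hom natnat P Q n"
      using g sdg closed by (simp add: natural_natural_Hom PQ' inv_def mor_ksgn mor_diff)
  qed
qed

section \<open>Splitting of idempotents\<close>

text \<open>
  A closed idempotent \<open>e = i p\<close> of \<open>(X, s)\<close> commutes with \<open>s\<close>, so \<open>p s i\<close> is a contracting homotopy of the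
  object that splits \<open>e\<close>, and \<open>p\<close> and \<open>i\<close> are compatible with it.
\<close>

lemma natural_idempotents_split:
  assumes split: "idempotents_split (Z0 A)"
  shows "idempotents_split (Z0 (natural_dg \<sigma> u A))"
  unfolding idempotents_split_def
proof (intro ballI impI)
  let ?N = "natural_dg \<sigma> u A"
  have unf: "Obj (Z0 ?N) = Ob ?N" "cmp (Z0 ?N) = comp A" "\<And>X s. ide (Z0 ?N) (X, s) = idm A X"
    by (simp_all add: Z0_def natural_dg_def)
  have Mor: "f \<in> Mor (Z0 ?N) (X, s) (Y, t) \<longleftrightarrow> f \<in> closed_mor A X Y 0 \<and> t \<cdot> f = f \<cdot> s"
    for X Y s t f by (auto simp: Z0_def natural_dg_def closed_mor_def form_zero)
  have Ob: "(X, s) \<in> Ob ?N \<longleftrightarrow> mor X X (- u) s \<and> dif A X X (- u) s = idm A X \<and> s \<cdot> s = 0" for X s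
    by (auto simp: natural_dg_def mor_def)
  fix P e assume P: "P \<in> Obj (Z0 ?N)" and e: "e \<in> Mor (Z0 ?N) P P" and ee: "e \<odot>\<^bsub>Z0 ?N\<^esub> e = e"
  obtain X s where PX: "P = (X, s)" by (cases P)
  have s: "mor X X (- u) s" and ds: "dif A X X (- u) s = idm A X" and ss: "s \<cdot> s = 0"
    using P by (simp_all add: PX unf Ob)
  have X: "X \<in> Ob A" using s by (simp add: mor_def)
  have e': "e \<in> closed_mor A X X 0" and se: "s \<cdot> e = e \<cdot> s" and ee': "e \<cdot> e = e"
    using e ee by (simp_all add: PX Mor unf)
  from split e' ee' X obtain Y p i where Y: "Y \<in> Ob A"
    and p: "p \<in> closed_mor A X Y 0" and i: "i \<in> closed_mor A Y X 0"
    and pi: "p \<cdot> i = idm A Y" and ip: "i \<cdot> p = e"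
    unfolding idempotents_split_def by (fastforce simp: Z0_def)
  have p': "mor X Y 0 p" "dif A X Y 0 p = 0" and i': "mor Y X 0 i" "dif A Y X 0 i = 0"
    and e'': "mor X X 0 e"
    using X Y p i e' by (simp_all add: closed_mor_def mor_def)
  define t where "t = p \<cdot> s \<cdot> i"
  have ps: "mor X Y (- u) (p \<cdot> s)" and si: "mor Y X (- u) (s \<cdot> i)"
    using mor_comp[OF s p'(1)] mor_comp[OF i'(1) s] by simp_all
  have t: "mor Y Y (- u) t" unfolding t_def using mor_comp[OF i'(1) ps] by simp
  have pe: "p \<cdot> e = p" and ei: "e \<cdot> i = i"
    using mor_assoc[OF p'(1) i'(1) p'(1)] mor_assoc[OF i'(1) p'(1) i'(1)] pi ip
    by (simp_all add: mor_idm_left[OF p'(1)] mor_idm_right[OF i'(1)])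
  have tp: "t \<cdot> p = p \<cdot> s"
    using mor_assoc[OF p'(1) i'(1) ps] mor_assoc[OF e'' s p'(1)] mor_assoc[OF s e'' p'(1)]
    by (simp add: t_def ip se pe)
  have it: "i \<cdot> t = s \<cdot> i"
    using mor_assoc[OF i'(1) s p'(1)] mor_assoc[OF si p'(1) i'(1)] mor_assoc[OF i'(1) s e'']
      mor_assoc[OF i'(1) e'' s]
    by (simp add: t_def ip se[symmetric] ei)
  have "dif A X Y (- u) (p \<cdot> s) = p"
    using mor_dif_comp[OF s p'(1)] by (simp add: p' ds mor_zero[OF s] mor_idm_right[OF p'(1)] form_zero)
  then have dt: "dif A Y Y (- u) t = idm A Y"
    using mor_dif_comp[OF i'(1) ps] by (simp add: t_def pi i' mor_zero[OF ps])
  have tt: "t \<cdot> t = 0"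
  proof -
    have "t \<cdot> t = p \<cdot> s \<cdot> (i \<cdot> t)" using mor_assoc[OF t i'(1) ps] by (simp add: t_def)
    also have "\<dots> = p \<cdot> (s \<cdot> s \<cdot> i)"
      unfolding it using mor_assoc[OF si s p'(1)] mor_assoc[OF i'(1) s s] by simp
    finally show ?thesis by (simp add: ss mor_zero[OF i'(1)] mor_zero[OF p'(1)])
  qed
  show "\<exists>Q\<in>Obj (Z0 ?N). \<exists>p\<in>Mor (Z0 ?N) P Q. \<exists>i\<in>Mor (Z0 ?N) Q P.
      p \<odot>\<^bsub>Z0 ?N\<^esub> i = ide (Z0 ?N) Q \<and> i \<odot>\<^bsub>Z0 ?N\<^esub> p = e"
    using t dt tt p i tp it pi ip by (intro bexI[of _ "(Y, t)"] bexI[of _ p] bexI[of _ i]) (auto simp: PX unf Ob Mor)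
qed

section \<open>Twisted objects as images\<close>

text \<open>
  By the Yoneda argument, the cone of \<open>id\<^sub>X\<close> is a biproduct of \<open>X\<close> and its shift \<open>X[1]\<close> with the projections
  \<open>p\<close>, \<open>q\<close> and the injections \<open>i\<close>, \<open>j\<close>, whose differentials can be read off from that of the cone. The
  degrees of \<open>j\<close> and \<open>q\<close> absorb the shift, so \<open>X[1]\<close> itself is not mentioned.
\<close>

lemma cone_of_identity:
  assumes cones: "has_cones u A" and X: "X \<in> Ob A"
  obtains C i j p q where
    "mor X C 0 i" "mor X C (- u) j" "mor C X 0 p" "mor C X u q"
    "dif A X C 0 i = 0" "dif A X C (- u) j = i" "dif A C X 0 p = - q" "dif A C X u q = 0"
    "p \<cdot> i = idm A X" "q \<cdot> j = idm A X" "p \<cdot> j = 0" "q \<cdot> i = 0" "i \<cdot> p + j \<cdot> q = idm A C"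
proof -
  have "idm A X \<in> closed_mor A X X 0" using X by (simp add: closed_mor_def idm_Hom dif_idm)
  then obtain C where "is_cone u A X X (idm A X) C" using cones X unfolding has_cones_def by blast
  then obtain \<Phi> where C: "C \<in> Ob A"
    and bij: "\<And>Z n. Z \<in> Ob A \<Longrightarrow> bij_betw (\<Phi> Z n) (Hom A Z C n) (cone_Hom u A X X Z n)"
    and add: "\<And>Z n a b. Z \<in> Ob A \<Longrightarrow> a \<in> Hom A Z C n \<Longrightarrow> b \<in> Hom A Z C n
      \<Longrightarrow> \<Phi> Z n (a + b) = \<Phi> Z n a + \<Phi> Z n b"
    and dif: "\<And>Z n a. Z \<in> Ob A \<Longrightarrow> a \<in> Hom A Z C n
      \<Longrightarrow> \<Phi> Z (n + u) (dif A Z C n a) = cone_dif u A X X (idm A X) Z n (\<Phi> Z n a)"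
    and comp: "\<And>Z Z' n m a h. Z \<in> Ob A \<Longrightarrow> Z' \<in> Ob A \<Longrightarrow> a \<in> Hom A Z C n \<Longrightarrow> h \<in> Hom A Z' Z m
      \<Longrightarrow> \<Phi> Z' (n + m) (a \<cdot> h) = map_prod (\<lambda>k. k \<cdot> h) (\<lambda>l. l \<cdot> h) (\<Phi> Z n a)"
    unfolding is_cone_def
    apply (elim conjE exE)
    subgoal for \<Phi> by (rule that[of \<Phi>]) simp_all
    done
  have surj: "\<exists>a\<in>Hom A X C n. \<Phi> X n a = kl" if "kl \<in> cone_Hom u A X X X n" for n kl
    using bij[OF X, of n] that unfolding bij_betw_def by (metis imageE)
  have inj: "a = b" if "Z \<in> Ob A" "mor Z C n a" "mor Z C n b" "\<Phi> Z n a = \<Phi> Z n b" for Z n a b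
    using bij[OF that(1), of n] that unfolding bij_betw_def mor_def by (meson inj_onD)
  \<comment> \<open>The universal element is the value at the identity; it determines \<open>\<Phi>\<close> by functoriality.\<close>
  obtain q p where qp: "\<Phi> C 0 (idm A C) = (q, p)" by (cases "\<Phi> C 0 (idm A C)")
  have idC: "mor C C 0 (idm A C)" using C by (rule mor_idm)
  have "(q, p) \<in> cone_Hom u A X X C 0"
    using bij_betwE[OF bij[OF C]] idC qp by (metis mor_def)
  then have p: "mor C X 0 p" and q: "mor C X u q" using C X by (auto simp: cone_Hom_def mor_def)
  have \<Phi>: "\<Phi> Z n h = (q \<cdot> h, p \<cdot> h)" if "mor Z C n h" for Z n h
    using comp[of C Z "idm A C" 0 h n] that C idC by (simp add: mor_def qp idm_left)
  obtain i where i: "mor X C 0 i" "\<Phi> X 0 i = (0, idm A X)"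
    using surj[of "(0, idm A X)" 0] X C by (auto simp: cone_Hom_def mor_def Hom_zero idm_Hom)
  obtain j where j: "mor X C (- u) j" "\<Phi> X (- u) j = (idm A X, 0)"
    using surj[of "(idm A X, 0)" "- u"] X C by (auto simp: cone_Hom_def mor_def Hom_zero idm_Hom)
  have zero: "q \<cdot> 0 = 0" "p \<cdot> 0 = 0" using p q by (simp_all add: mor_zero[OF p] mor_zero[OF q])
  have z: "mor X C n 0" "mor C C n 0" for n using X C by (simp_all add: mor_def Hom_zero)
  have \<Phi>0: "\<Phi> X n 0 = (0, 0)" for n using \<Phi>[OF z(1)] zero by simp
  have eqs: "q \<cdot> i = 0" "p \<cdot> i = idm A X" "q \<cdot> j = idm A X" "p \<cdot> j = 0"
    using \<Phi>[OF i(1)] \<Phi>[OF j(1)] i(2) j(2) by simp_all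
  have "dif A X C 0 i = 0"
    using dif[OF X, of i 0] i X mor_dif[OF i(1)] z(1) \<Phi>0
    by (intro inj[OF X]) (auto simp: cone_dif_def mor_def idm_Hom dif_idm dif_zero mor_zero(2)[OF mor_idm[OF X]])
  moreover have "dif A X C (- u) j = i"
    using dif[OF X, of j "- u"] i j X mor_dif[OF j(1)]
    by (intro inj[OF X]) (auto simp: cone_dif_def mor_def idm_Hom dif_idm dif_zero mor_idm_left[OF mor_idm[OF X]])
  moreover have "dif A C X u q = 0 \<and> dif A C X 0 p = - q"
  proof -
    have "(0, 0) = \<Phi> C u (dif A C C 0 (idm A C))" using \<Phi>[OF z(2)] zero dif_idm[OF C] by simp
    also have "\<dots> = (- dif A C X u q, q + dif A C X 0 p)"
      using dif[OF C, of "idm A C" 0] idC by (simp add: mor_def cone_dif_def qp mor_idm_left[OF q])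
    finally show ?thesis by (simp add: eq_neg_iff_add_eq_0 add.commute)
  qed
  moreover have "i \<cdot> p + j \<cdot> q = idm A C"
  proof -
    have ip: "mor C C 0 (i \<cdot> p)" and jq: "mor C C 0 (j \<cdot> q)"
      using mor_comp[OF p i(1)] mor_comp[OF q j(1)] by simp_all
    have "\<Phi> C 0 (i \<cdot> p) = (0, p)" "\<Phi> C 0 (j \<cdot> q) = (q, 0)"
      using comp[of X C i 0 p 0] comp[of X C j "- u" q u] i j p q
      by (simp_all add: mor_def idm_left mor_zero[OF p] mor_zero[OF q])
    then have "\<Phi> C 0 (i \<cdot> p + j \<cdot> q) = \<Phi> C 0 (idm A C)"
      using add[OF C, of "i \<cdot> p" 0 "j \<cdot> q"] ip jq qp by (simp add: mor_def)
    then show ?thesis using ip jq idC by (intro inj[OF C]) (auto intro: mor_add)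
  qed
  ultimately show thesis using that i(1) j(1) p q eqs by blast
qed

text \<open>
  With \<open>\<phi> = i + j a\<close> and \<open>\<theta> = q - a p\<close>, the graded object \<open>C\<close> is again a biproduct, now with injections
  \<open>\<phi>\<close>, \<open>j\<close> and projections \<open>p\<close>, \<open>\<theta>\<close>. Put \<open>s = j p\<close> and \<open>t = \<phi> \<theta>\<close>, so that \<open>t s = \<phi> p\<close> is the projector
  onto the summand \<open>X\<close>. The correction terms with \<open>a\<close> are chosen so that \<open>d \<phi> = \<phi> a\<close> and \<open>d \<theta> = - a \<theta>\<close>,
  by the Maurer--Cartan equation. Then \<open>t\<close> is closed, and \<open>\<phi>\<close> and \<open>p\<close> are closed for the differential
  twisted by \<open>a\<close> on \<open>X\<close> and by \<open>- t\<close> on \<open>C\<close>; they are the required isomorphisms.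
\<close>

lemma mc_object_in_image:
  assumes cones: "has_cones u A" and P: "(X, a) \<in> Ob (mc_dg \<sigma> u A)"
  shows "\<exists>Q\<in>Ob natnat.
    isomorphic_in (Z0 mc_idem) (to_idem_mc Q) ((X, a), idm A X)"
proof -
  have X: "X \<in> Ob A" and a: "mor X X u a" and da: "dif A X X u a = - (a \<cdot> a)"
    using P by (auto simp: mc_dg_def mor_def eq_neg_iff_add_eq_0)
  obtain C i j p q where
    i: "mor X C 0 i" and j: "mor X C (- u) j" and p: "mor C X 0 p" and q: "mor C X u q"
    and d: "dif A X C 0 i = 0" "dif A X C (- u) j = i" "dif A C X 0 p = - q" "dif A C X u q = 0"
    and eqs: "p \<cdot> i = idm A X" "q \<cdot> j = idm A X" "p \<cdot> j = 0" "q \<cdot> i = 0"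
    and sum: "i \<cdot> p + j \<cdot> q = idm A C"
    using cone_of_identity[OF cones X] by metis
  have aa: "mor X X (u + u) (a \<cdot> a)" using mor_comp[OF a a] by simp
  have daa: "dif A X X (u + u) (a \<cdot> a) = 0"
    using mor_dif_comp[OF a a] mor_assoc[OF a a a]
    by (simp add: da form_unit mor_minus_left[OF a aa] mor_minus_right[OF aa a])
  define \<phi> where "\<phi> = i + j \<cdot> a"
  define \<theta> where "\<theta> = q - a \<cdot> p"
  have ja: "mor X C 0 (j \<cdot> a)" and ap: "mor C X u (a \<cdot> p)"
    using mor_comp[OF a j] mor_comp[OF p a] by simp_all
  have \<phi>: "mor X C 0 \<phi>" and \<theta>: "mor C X u \<theta>"
    unfolding \<phi>_def \<theta>_def using mor_add[OF i ja] mor_diff[OF q ap] by simp_all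
  define s where "s = j \<cdot> p"
  define t where "t = \<phi> \<cdot> \<theta>"
  have s: "mor C C (- u) s" and t: "mor C C u t"
    unfolding s_def t_def using mor_comp[OF p j] mor_comp[OF \<theta> \<phi>] by simp_all
  have p\<phi>: "p \<cdot> \<phi> = idm A X"
    using mor_assoc[OF a j p] by (simp add: \<phi>_def mor_add_right[OF i ja p] eqs mor_zero[OF a])
  have \<theta>j: "\<theta> \<cdot> j = idm A X"
    using mor_assoc[OF j p a] by (simp add: \<theta>_def mor_diff_left[OF j q ap] eqs mor_zero[OF a])
  have \<theta>\<phi>: "\<theta> \<cdot> \<phi> = 0"
  proof -
    have "q \<cdot> \<phi> = a"
      using mor_assoc[OF a j q] by (simp add: \<phi>_def mor_add_right[OF i ja q] eqs mor_idm_left[OF a])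
    then show ?thesis
      using mor_assoc[OF \<phi> p a] by (simp add: \<theta>_def mor_diff_left[OF \<phi> q ap] p\<phi> mor_idm_right[OF a])
  qed
  have d\<phi>: "dif A X C 0 \<phi> = \<phi> \<cdot> a"
    using mor_dif_comp[OF a j] mor_assoc[OF a a j]
    by (simp add: \<phi>_def mor_dif_add[OF i ja] mor_add_left[OF a i ja] d da form_minus form_unit
        mor_minus_right[OF aa j])
  have d\<theta>: "dif A C X u \<theta> = - (a \<cdot> \<theta>)"
    using mor_dif_comp[OF p a] mor_assoc[OF p a a]
    by (simp add: \<theta>_def mor_dif_diff[OF q ap] mor_diff_right[OF q ap a] d da form_unit
        mor_minus_left[OF p aa] mor_minus_right[OF q a])
  have ts: "t \<cdot> s = \<phi> \<cdot> p"
    using mor_assoc[OF s \<theta> \<phi>] mor_assoc[OF p j \<theta>] by (simp add: t_def s_def \<theta>j mor_idm_left[OF p])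
  have st: "s \<cdot> t = j \<cdot> \<theta>"
    using mor_assoc[OF \<theta> \<phi> s] mor_assoc[OF \<phi> p j] by (simp add: t_def s_def p\<phi> mor_idm_right[OF j])
  have "s \<cdot> t + t \<cdot> s = idm A C"
  proof -
    have "s \<cdot> t + t \<cdot> s = j \<cdot> q - j \<cdot> (a \<cdot> p) + (i \<cdot> p + j \<cdot> (a \<cdot> p))"
      unfolding ts st unfolding \<theta>_def \<phi>_def mor_diff_right[OF q ap j] mor_add_left[OF p i ja] mor_assoc[OF p a j] ..
    then show ?thesis using sum by (simp add: add.commute)
  qed
  moreover have "s \<cdot> s = 0"
    using mor_assoc[OF s p j] mor_assoc[OF p j p] by (simp add: s_def eqs mor_zero[OF p] mor_zero[OF j])
  moreover have "t \<cdot> t = 0"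
    using mor_assoc[OF t \<theta> \<phi>] mor_assoc[OF \<theta> \<phi> \<theta>] by (simp add: t_def \<theta>\<phi> mor_zero[OF \<theta>] mor_zero[OF \<phi>])
  moreover have "dif A C C (- u) s = idm A C"
    using mor_dif_comp[OF p j] sum by (simp add: s_def d form_minus form_unit mor_minus_right[OF q j])
  moreover have "dif A C C u t = 0"
    using mor_dif_comp[OF \<theta> \<phi>] mor_assoc[OF \<theta> a \<phi>] mor_comp[OF \<theta> a refl]
    by (simp add: t_def d\<phi> d\<theta> form_zero mor_minus_right[OF _ \<phi>])
  ultimately have Q: "((C, s), t) \<in> Ob natnat"
    using s t by (simp add: natural_natural_Ob)
  have idX: "((X, a), idm A X) \<in> Ob mc_idem"
    using X a by (simp add: idem_mc_Ob da mor_idm dif_idm mor_idm_left[OF a] mor_idm_right[OF a]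
        mor_idm_left[OF mor_idm[OF X]])
  note GQ = natural_natural_image_Ob[OF Q]
  have "\<phi> \<in> Hom mc_idem ((X, a), idm A X) ((C, - t), t \<cdot> s) 0"
    using mor_assoc[OF \<phi> p \<phi>] unfolding idem_mc_Hom[OF idX GQ] by (simp add: \<phi> ts p\<phi> mor_idm_right[OF \<phi>])
  moreover have "t \<cdot> \<phi> = 0"
    using mor_assoc[OF \<phi> \<theta> \<phi>] by (simp add: t_def \<theta>\<phi> mor_zero[OF \<phi>])
  ultimately have
    "\<phi> \<in> closed_mor mc_idem ((X, a), idm A X) ((C, - t), t \<cdot> s) 0"
    by (simp add: closed_mor_def idem_mc_simps d\<phi> mor_minus_left[OF \<phi> t] form_zero)
  moreover have "p \<in> Hom mc_idem ((C, - t), t \<cdot> s) ((X, a), idm A X) 0"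
    using mor_assoc[OF p \<phi> p] unfolding idem_mc_Hom[OF GQ idX] by (simp add: p ts p\<phi> mor_idm_left[OF p])
  moreover have "p \<cdot> t = \<theta>"
    using mor_assoc[OF \<theta> \<phi> p] by (simp add: t_def p\<phi> mor_idm_left[OF \<theta>])
  ultimately have
    "\<phi> \<in> closed_mor mc_idem ((X, a), idm A X) ((C, - t), t \<cdot> s) 0"
    "p \<in> closed_mor mc_idem ((C, - t), t \<cdot> s) ((X, a), idm A X) 0"
    by (simp_all add: closed_mor_def idem_mc_simps d mor_minus_right[OF t p] form_zero \<theta>_def)
  then have "isomorphic_in (Z0 mc_idem) (to_idem_mc ((C, s), t)) ((X, a), idm A X)"
    unfolding isomorphic_in_def
    by (intro bexI[of _ p] bexI[of _ \<phi>]) (simp_all add: Z0_def idem_mc_simps to_idem_mc_def ts p\<phi>)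
  then show ?thesis using Q by blast
qed

end

section \<open>Retracts and the comparison\<close>

text \<open>
  A retract \<open>P\<close> of \<open>F Q\<close> gives an idempotent \<open>i r\<close> of \<open>F Q\<close>. It lifts along the fully faithful \<open>F\<close>; the
  object that splits the lift has an image that splits \<open>i r\<close>, as \<open>P\<close> does, and splittings are unique up
  to isomorphism.
\<close>

lemma fully_faithful_retract:
  assumes B: "dg_category \<sigma> u B" and D: "dg_category \<sigma> u D"
    and F: "dg_functor u B D F \<phi>"
    and ff: "\<And>X Y n. X \<in> Ob B \<Longrightarrow> Y \<in> Ob B \<Longrightarrow> bij_betw (\<phi> X Y n) (Hom B X Y n) (Hom D (F X) (F Y) n)"
    and split: "idempotents_split (Z0 B)"
    and Q: "Q \<in> Ob B" and P: "P \<in> Ob D"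
    and r: "r \<in> closed_mor D (F Q) P 0" and i: "i \<in> closed_mor D P (F Q) 0"
    and ri: "r \<cdot>\<^bsub>D\<^esub> i = idm D P"
  shows "\<exists>Y\<in>Ob B. isomorphic_in (Z0 D) (F Y) P"
proof -
  interpret B: dg_category \<sigma> u B by (rule B)
  interpret D: dg_category \<sigma> u D by (rule D)
  have FOb: "F X \<in> Ob D" if "X \<in> Ob B" for X using dg_functorD(1)[OF F that that] .
  have Fcl: "\<phi> X Y 0 f \<in> closed_mor D (F X) (F Y) 0"
    if "X \<in> Ob B" "Y \<in> Ob B" "f \<in> closed_mor B X Y 0" for X Y f
  proof -
    have f: "f \<in> Hom B X Y 0" "dif B X Y 0 f = 0" using that(3) by (simp_all add: closed_mor_def)
    have "dif D (F X) (F Y) 0 (\<phi> X Y 0 f) = \<phi> X Y (0 + u) 0"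
      using dg_functorD(4)[OF F that(1,2) f(1)] f(2) by simp
    also have "\<dots> = 0"
    proof -
      have "\<phi> X Y (0 + u) (0 + 0) = \<phi> X Y (0 + u) 0 + \<phi> X Y (0 + u) 0"
        using dg_functorD(3)[OF F that(1,2)] B.Hom_zero that(1,2) by blast
      then show ?thesis by simp
    qed
    finally show ?thesis using dg_functorD(2)[OF F that(1,2) f(1)] by (simp add: closed_mor_def)
  qed
  have Fcomp: "\<phi> X Z 0 (g \<cdot>\<^bsub>B\<^esub> f) = \<phi> Y Z 0 g \<cdot>\<^bsub>D\<^esub> \<phi> X Y 0 f"
    if "X \<in> Ob B" "Y \<in> Ob B" "Z \<in> Ob B" "f \<in> Hom B X Y 0" "g \<in> Hom B Y Z 0" for X Y Z f g
  proof -
    have "\<phi> X Z (0 + 0) (g \<cdot>\<^bsub>B\<^esub> f) = \<phi> Y Z 0 g \<cdot>\<^bsub>D\<^esub> \<phi> X Y 0 f"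
      using dg_functorD(5)[OF F that] .
    then show ?thesis by simp
  qed
  have inj: "f = g" if "X \<in> Ob B" "Y \<in> Ob B" "f \<in> Hom B X Y n" "g \<in> Hom B X Y n" "\<phi> X Y n f = \<phi> X Y n g"
    for X Y n f g using ff[OF that(1,2)] that(3-) unfolding bij_betw_def by (meson inj_onD)
  have r': "D.mor (F Q) P 0 r" and i': "D.mor P (F Q) 0 i"
    using r i P FOb[OF Q] by (auto simp: closed_mor_def D.mor_def)
  have ir: "i \<cdot>\<^bsub>D\<^esub> r \<in> closed_mor D (F Q) (F Q) 0"
    using D.closed_mor_comp[OF FOb[OF Q] P FOb[OF Q] r i] by simp
  then obtain e where e: "e \<in> Hom B Q Q 0" and \<phi>e: "\<phi> Q Q 0 e = i \<cdot>\<^bsub>D\<^esub> r"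
    using ff[OF Q Q, of 0] unfolding bij_betw_def closed_mor_def
    by (metis (no_types, lifting) imageE mem_Collect_eq)
  have "dif B Q Q 0 e = 0"
  proof (rule inj[OF Q Q])
    show "dif B Q Q 0 e \<in> Hom B Q Q (0 + u)" "0 \<in> Hom B Q Q (0 + u)"
      using B.dif_Hom[OF Q Q e] B.Hom_zero[OF Q Q] by blast+
    have "\<phi> Q Q (0 + u) (0 + 0) = \<phi> Q Q (0 + u) 0 + \<phi> Q Q (0 + u) 0"
      using dg_functorD(3)[OF F Q Q] B.Hom_zero Q by blast
    moreover have "\<phi> Q Q (0 + u) (dif B Q Q 0 e) = dif D (F Q) (F Q) 0 (\<phi> Q Q 0 e)"
      using dg_functorD(4)[OF F Q Q e] .
    ultimately show "\<phi> Q Q (0 + u) (dif B Q Q 0 e) = \<phi> Q Q (0 + u) 0"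
      using ir by (simp add: \<phi>e closed_mor_def)
  qed
  then have ecl: "e \<in> closed_mor B Q Q 0" using e by (simp add: closed_mor_def)
  have iri: "r \<cdot>\<^bsub>D\<^esub> (i \<cdot>\<^bsub>D\<^esub> r) = r"
    using D.mor_assoc[OF r' i' r'] ri D.mor_idm_left[OF r'] by simp
  have ir': "D.mor (F Q) (F Q) 0 (i \<cdot>\<^bsub>D\<^esub> r)" using D.mor_comp[OF r' i'] by simp
  have "e \<cdot>\<^bsub>B\<^esub> e = e"
  proof (rule inj[OF Q Q])
    show "e \<cdot>\<^bsub>B\<^esub> e \<in> Hom B Q Q 0" using B.comp_Hom[OF Q Q Q e e] by simp
    show "\<phi> Q Q 0 (e \<cdot>\<^bsub>B\<^esub> e) = \<phi> Q Q 0 e"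
      using Fcomp[OF Q Q Q e e] D.mor_assoc[OF ir' r' i'] iri by (simp add: \<phi>e)
  qed (rule e)
  with split ecl Q obtain Y p k where Y: "Y \<in> Ob B" and p: "p \<in> closed_mor B Q Y 0"
    and k: "k \<in> closed_mor B Y Q 0" and pk: "p \<cdot>\<^bsub>B\<^esub> k = idm B Y" and kp: "k \<cdot>\<^bsub>B\<^esub> p = e"
    unfolding idempotents_split_def by (fastforce simp: Z0_def)
  define p' where "p' = \<phi> Q Y 0 p"
  define k' where "k' = \<phi> Y Q 0 k"
  have p'cl: "p' \<in> closed_mor D (F Q) (F Y) 0" and k'cl: "k' \<in> closed_mor D (F Y) (F Q) 0"
    unfolding p'_def k'_def using Fcl Q Y p k by blast+
  have p': "D.mor (F Q) (F Y) 0 p'" and k': "D.mor (F Y) (F Q) 0 k'"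
    using p'cl k'cl FOb Q Y by (simp_all add: closed_mor_def D.mor_def)
  have "\<phi> Y Y 0 (idm B Y) = idm D (F Y)" using dg_functorD(6)[OF F Y Y] .
  then have pk': "p' \<cdot>\<^bsub>D\<^esub> k' = idm D (F Y)" and kp': "k' \<cdot>\<^bsub>D\<^esub> p' = i \<cdot>\<^bsub>D\<^esub> r"
    unfolding p'_def k'_def using Fcomp[of Y Q Y k p] Fcomp[of Q Y Q p k] Q Y p k
    by (simp_all add: pk kp \<phi>e closed_mor_def)
  have rk: "D.mor (F Y) P 0 (r \<cdot>\<^bsub>D\<^esub> k')"
    using D.mor_comp[OF k' r'] by simp
  have "r \<cdot>\<^bsub>D\<^esub> k' \<in> closed_mor D (F Y) P 0" "p' \<cdot>\<^bsub>D\<^esub> i \<in> closed_mor D P (F Y) 0"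
    using D.closed_mor_comp[OF FOb[OF Y] FOb[OF Q] P k'cl r]
      D.closed_mor_comp[OF P FOb[OF Q] FOb[OF Y] i p'cl] by simp_all
  moreover have "p' \<cdot>\<^bsub>D\<^esub> i \<cdot>\<^bsub>D\<^esub> (r \<cdot>\<^bsub>D\<^esub> k') = idm D (F Y)"
  proof -
    have "p' \<cdot>\<^bsub>D\<^esub> i \<cdot>\<^bsub>D\<^esub> (r \<cdot>\<^bsub>D\<^esub> k') = p' \<cdot>\<^bsub>D\<^esub> (k' \<cdot>\<^bsub>D\<^esub> p' \<cdot>\<^bsub>D\<^esub> k')"
      using D.mor_assoc[OF rk i' p'] D.mor_assoc[OF k' r' i'] kp' by simp
    then show ?thesis using D.mor_assoc[OF k' p' k'] D.mor_idm_right[OF k'] pk' by simp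
  qed
  moreover have "r \<cdot>\<^bsub>D\<^esub> k' \<cdot>\<^bsub>D\<^esub> (p' \<cdot>\<^bsub>D\<^esub> i) = idm D P"
  proof -
    have "r \<cdot>\<^bsub>D\<^esub> k' \<cdot>\<^bsub>D\<^esub> (p' \<cdot>\<^bsub>D\<^esub> i) = r \<cdot>\<^bsub>D\<^esub> k' \<cdot>\<^bsub>D\<^esub> p' \<cdot>\<^bsub>D\<^esub> i"
      using D.mor_assoc[OF i' p' rk] by simp
    also have "r \<cdot>\<^bsub>D\<^esub> k' \<cdot>\<^bsub>D\<^esub> p' = r"
      using D.mor_assoc[OF p' k' r'] kp' iri by simp
    finally show ?thesis using ri by simp
  qed
  ultimately show ?thesis
    using Y by (auto simp: isomorphic_in_def Z0_def)
qed

theorem proposition3p14: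
  fixes \<sigma> :: "'g::ab_group_add \<Rightarrow> 'g \<Rightarrow> bit" and u :: 'g
    and A :: "('o, 'g, 'm::ab_group_add) dgcat"
  assumes "dg_category \<sigma> u A" and "dg_additive A" and "has_shifts A" and "has_cones u A"
  shows "\<exists>S G \<gamma>.
    idem_embedding_obs (mc_dg \<sigma> u A) \<subseteq> S \<and>
    S \<subseteq> Ob (idem_dg (mc_dg \<sigma> u A)) \<and>
    dg_equivalence u (natural_dg \<sigma> u (natural_dg \<sigma> u A))
      (full_dg_subcat (idem_dg (mc_dg \<sigma> u A)) S) G \<gamma> \<and>
    (dg_idempotent_complete A \<longrightarrow> S = Ob (idem_dg (mc_dg \<sigma> u A)))"
proof -
  interpret A: dg_category \<sigma> u A by (rule assms(1))
  interpret N: dg_category \<sigma> u "natural_dg \<sigma> u A" by (rule A.dg_category_natural_dg)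
  interpret M: dg_category \<sigma> u "mc_dg \<sigma> u A" by (rule A.dg_category_mc_dg)
  let ?N = "natural_dg \<sigma> u (natural_dg \<sigma> u A)" and ?I = "idem_dg (mc_dg \<sigma> u A)"
  let ?G = A.to_idem_mc and ?\<gamma> = A.to_idem_mc_mor
  interpret I: dg_category \<sigma> u ?I by (rule M.dg_category_idem_dg)
  \<comment> \<open>The image itself need not contain the objects \<open>(P, id)\<close>, only isomorphic ones; hence its closure.\<close>
  define S where "S = {P \<in> Ob ?I. \<exists>Q\<in>Ob ?N. isomorphic_in (Z0 ?I) (?G Q) P}"
  have Gob: "?G Q \<in> Ob ?I" if "Q \<in> Ob ?N" for Q
    using dg_functorD(1)[OF A.dg_functor_to_idem_mc that that] .
  have emb: "idem_embedding_obs (mc_dg \<sigma> u A) \<subseteq> Ob ?I"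
    using M.idm_Hom M.dif_idm M.idm_left
    by (fastforce simp: idem_embedding_obs_def idem_dg_def closed_mor_def)
  have idm: "idm (mc_dg \<sigma> u A) (X, a) = idm A X" for X a by (simp add: mc_dg_def)
  have 1: "idem_embedding_obs (mc_dg \<sigma> u A) \<subseteq> S"
    using emb A.mc_object_in_image[OF assms(4)] unfolding S_def idem_embedding_obs_def
    by (auto simp: idm)
  have GS: "?G Q \<in> S" if Q: "Q \<in> Ob ?N" for Q
  proof -
    have "isomorphic_in (Z0 ?I) (?G Q) (?G Q)"
      using I.idm_Hom[OF Gob[OF Q]] I.dif_idm[OF Gob[OF Q]]
        I.idm_left[OF Gob[OF Q] Gob[OF Q] I.idm_Hom[OF Gob[OF Q]]]
      by (auto simp: isomorphic_in_def Z0_def closed_mor_def)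
    then show ?thesis using Q Gob by (auto simp: S_def)
  qed
  have "dg_functor u ?N (full_dg_subcat ?I S) ?G ?\<gamma>"
    using A.dg_functor_to_idem_mc GS unfolding dg_functor_def full_dg_subcat_def by simp
  moreover have "isomorphic_in (Z0 (full_dg_subcat ?I S)) = isomorphic_in (Z0 ?I)"
    by (intro ext) (simp add: isomorphic_in_def Z0_def full_dg_subcat_def closed_mor_def)
  ultimately have 2: "dg_equivalence u ?N (full_dg_subcat ?I S) ?G ?\<gamma>"
    unfolding dg_equivalence_def using A.to_idem_mc_fully_faithful
    by (auto simp: S_def full_dg_subcat_def)
  have 3: "P \<in> S" if complete: "dg_idempotent_complete A" and P: "P \<in> Ob ?I" for P
  proof -
    \<comment> \<open>\<open>((X, a), e)\<close> is a retract of \<open>((X, a), id)\<close>, with \<open>e\<close> as both maps.\<close>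
    obtain X a e where PX: "P = ((X, a), e)" by (metis surj_pair)
    let ?P = "((X, a), idm A X)"
    have e: "(X, a) \<in> Ob (mc_dg \<sigma> u A)" "e \<in> closed_mor (mc_dg \<sigma> u A) (X, a) (X, a) 0" "e \<cdot>\<^bsub>A\<^esub> e = e"
      using P by (auto simp: PX idem_dg_def mc_dg_def)
    then have obP: "?P \<in> Ob ?I" using emb by (auto simp: idem_embedding_obs_def idm)
    have e': "A.mor X X 0 e" using P by (simp add: PX A.idem_mc_Ob)
    have "e \<in> Hom ?I ?P P 0" "e \<in> Hom ?I P ?P 0"
      unfolding PX A.idem_mc_Hom[OF obP P[unfolded PX]] A.idem_mc_Hom[OF P[unfolded PX] obP]
      by (simp_all add: e' e(3) A.mor_idm_left[OF e'] A.mor_idm_right[OF e'])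
    then have ee: "e \<in> closed_mor ?I ?P P 0" "e \<in> closed_mor ?I P ?P 0"
      using e(2) by (simp_all add: PX closed_mor_def A.idem_mc_simps) (simp_all add: mc_dg_def)
    obtain Q f g where Q: "Q \<in> Ob ?N" and f: "f \<in> closed_mor ?I (?G Q) ?P 0"
      and g: "g \<in> closed_mor ?I ?P (?G Q) 0" and fg: "f \<cdot>\<^bsub>A\<^esub> g = idm A X"
      using A.mc_object_in_image[OF assms(4) e(1)]
      by (auto simp: isomorphic_in_def Z0_def A.idem_mc_simps)
    have "idempotents_split (Z0 ?N)"
      using complete A.natural_idempotents_split N.natural_idempotents_split
      by (auto simp: dg_idempotent_complete_def)
    moreover have "e \<cdot>\<^bsub>A\<^esub> f \<in> closed_mor ?I (?G Q) P 0" "g \<cdot>\<^bsub>A\<^esub> e \<in> closed_mor ?I P (?G Q) 0"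
      using I.closed_mor_comp[OF Gob[OF Q] obP P f ee(1)] I.closed_mor_comp[OF P obP Gob[OF Q] ee(2) g]
      by (simp_all add: A.idem_mc_simps)
    moreover have "e \<cdot>\<^bsub>A\<^esub> f \<cdot>\<^bsub>A\<^esub> (g \<cdot>\<^bsub>A\<^esub> e) = e"
    proof -
      obtain C b c where GQ: "?G Q = ((C, b), c)" by (metis surj_pair)
      have f': "A.mor C X 0 f" and g': "A.mor X C 0 g"
        using f g obP Gob[OF Q] by (simp_all add: GQ closed_mor_def A.idem_mc_Hom)
      show ?thesis
        using A.mor_assoc[OF A.mor_comp[OF e' g' refl] f' e'] A.mor_assoc[OF e' g' f'] fg e(3)
        by (simp add: A.mor_idm_left[OF e'])
    qed
    ultimately show ?thesis
      using fully_faithful_retract[OF N.dg_category_natural_dg I.dg_category_axioms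
          A.dg_functor_to_idem_mc A.to_idem_mc_fully_faithful _ Q P] P
      by (auto simp: S_def PX A.idem_mc_simps)
  qed
  show ?thesis
  proof (intro exI conjI impI)
    show "S = Ob ?I" if "dg_idempotent_complete A" using 3[OF that] by (auto simp: S_def)
  qed (use 1 2 in \<open>auto simp: S_def\<close>)
qed

end
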